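(* Let $k\geq 3$, let $n$ be a positive odd integer, and let $G_1=P_1\times\cdots\times P_m$ ($m\geq 1$) be a finite nilpotent group of odd order whose Sylow subgroups $P_1,\dots,P_m$ (for the distinct prime divisors $p_1,\dots,p_m$ of $|G_1|$) are not cyclic. Let $r_i$ be the number of distinct subgroups of order $p_i$ in $P_i$, indexed so that $r_1\leq r_2\leq\cdots\leq r_m$. (a) If $G=Q_{2^k}$ or $G=\mathbb{Z}_n\times Q_{2^k}$, then $\gamma^{\text{strong}}(\mathcal{G}_E^{**}(G))=2^{k-1}+2$. (b) If $G=G_1\times Q_{2^k}$, or $G=G_1\times\mathbb{Z}_n\times Q_{2^k}$ with $\gcd(|G_1|,n)=1$, then $\gamma^{\text{strong}}(\mathcal{G}_E^{**}(G))=\min\{r_1,\,2^{k-2}+1\}+1$.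
   Context: $\mathbb{Z}_n$ denotes the cyclic group of order $n$. The generalized quaternion group $Q_{2^k}$ ($k\geq 3$) is the group of order $2^k$ generated by $x,y$ with $x^{2^{k-1}}=1$, $x^{2^{k-2}}=y^2$ and $yxy^{-1}=x^{-1}$. The enhanced power graph $\mathcal{G}_E(G)$ of a group $G$ is the simple graph with vertex set $G$ in which two distinct vertices $u,v$ are adjacent if and only if there is $w\in G$ with $u\in\langle w\rangle$ and $v\in\langle w\rangle$. A dominating vertex of a graph is a vertex adjacent to every other vertex. The proper enhanced power graph $\mathcal{G}_E^{**}(G)$ is the graph obtained from $\mathcal{G}_E(G)$ by deleting all of its dominating vertices (including the identity). A total dominating set (or strongly dominating set) of a graph $\Gamma=(V,E)$ is a set $D\subseteq V$ such that every vertex $u\in V$ (including those in $D$) is adjacent to some $v\in D$. The strong domination number $\gamma^{\text{strong}}(\Gamma)$ is the minimum cardinality of a total dominating set of $\Gamma$. *)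

theory Defs
  imports "HOL-Algebra.Product_Groups" "HOL-Computational_Algebra.Primes"
begin

section \<open>Simple graphs and total domination\<close>

text \<open>Edges are two-element sets of vertices.\<close>

record 'a sgraph =
  verts :: "'a set"
  edges :: "'a set set"

definition adjacent :: "'a sgraph \<Rightarrow> 'a \<Rightarrow> 'a \<Rightarrow> bool"
  where "adjacent \<Gamma> u v \<longleftrightarrow> {u, v} \<in> edges \<Gamma>"

definition delete_vertices :: "'a sgraph \<Rightarrow> 'a set \<Rightarrow> 'a sgraph"
  where "delete_vertices \<Gamma> S =
    \<lparr>verts = verts \<Gamma> - S, edges = {e \<in> edges \<Gamma>. e \<inter> S = {}}\<rparr>"

definition dominating_vertices :: "'a sgraph \<Rightarrow> 'a set"
  where "dominating_vertices \<Gamma> =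
    {u \<in> verts \<Gamma>. \<forall>v \<in> verts \<Gamma>. v \<noteq> u \<longrightarrow> adjacent \<Gamma> u v}"

definition total_dominating_set :: "'a sgraph \<Rightarrow> 'a set \<Rightarrow> bool"
  where "total_dominating_set \<Gamma> D \<longleftrightarrow>
    D \<subseteq> verts \<Gamma> \<and> (\<forall>u \<in> verts \<Gamma>. \<exists>v \<in> D. adjacent \<Gamma> u v)"

text \<open>The value is meaningful only when a finite total dominating set exists; for a finite graph
  this means that there is no isolated vertex.\<close>

definition strong_domination_number :: "'a sgraph \<Rightarrow> nat"
  where "strong_domination_number \<Gamma> =
    (LEAST c. \<exists>D. total_dominating_set \<Gamma> D \<and> finite D \<and> card D = c)"

section \<open>Enhanced power graphs\<close>

definition enhanced_power_graph :: "('a, 'b) monoid_scheme \<Rightarrow> 'a sgraph"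
  where "enhanced_power_graph G =
    \<lparr>verts = carrier G,
     edges = {{u, v} | u v. u \<in> carrier G \<and> v \<in> carrier G \<and> u \<noteq> v \<and>
       (\<exists>w \<in> carrier G. u \<in> generate G {w} \<and> v \<in> generate G {w})}\<rparr>"

definition proper_enhanced_power_graph :: "('a, 'b) monoid_scheme \<Rightarrow> 'a sgraph"
  where "proper_enhanced_power_graph G =
    delete_vertices (enhanced_power_graph G) (dominating_vertices (enhanced_power_graph G))"

section \<open>Groups\<close>

text \<open>This presentation together with the order determines the group up to isomorphism.\<close>

definition generalized_quaternion :: "nat \<Rightarrow> ('a, 'b) monoid_scheme \<Rightarrow> bool"
  where "generalized_quaternion k Q \<longleftrightarrow>
    group Q \<and> order Q = 2 ^ k \<and>
    (\<exists>x \<in> carrier Q. \<exists>y \<in> carrier Q.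
      generate Q {x, y} = carrier Q \<and>
      x [^]\<^bsub>Q\<^esub> ((2::nat) ^ (k - 1)) = \<one>\<^bsub>Q\<^esub> \<and>
      x [^]\<^bsub>Q\<^esub> ((2::nat) ^ (k - 2)) = y [^]\<^bsub>Q\<^esub> (2::nat) \<and>
      y \<otimes>\<^bsub>Q\<^esub> x \<otimes>\<^bsub>Q\<^esub> inv\<^bsub>Q\<^esub> y = inv\<^bsub>Q\<^esub> x)"

fun lower_central_series :: "('a, 'b) monoid_scheme \<Rightarrow> nat \<Rightarrow> 'a set"
  where
    "lower_central_series G 0 = carrier G"
  | "lower_central_series G (Suc i) =
      generate G {g \<otimes>\<^bsub>G\<^esub> h \<otimes>\<^bsub>G\<^esub> inv\<^bsub>G\<^esub> g \<otimes>\<^bsub>G\<^esub> inv\<^bsub>G\<^esub> h | g h.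
        g \<in> lower_central_series G i \<and> h \<in> carrier G}"

definition nilpotent_group :: "('a, 'b) monoid_scheme \<Rightarrow> bool"
  where "nilpotent_group G \<longleftrightarrow> group G \<and> (\<exists>c. lower_central_series G c = {\<one>\<^bsub>G\<^esub>})"

text \<open>For finite groups only: \<open>order G = 0\<close> if the carrier is infinite.\<close>

definition sylow_subgroup :: "nat \<Rightarrow> 'a set \<Rightarrow> ('a, 'b) monoid_scheme \<Rightarrow> bool"
  where "sylow_subgroup p H G \<longleftrightarrow>
    prime p \<and> subgroup H G \<and> card H = p ^ multiplicity p (order G)"

end

theory Submission
  imports Defs "HOL-Number_Theory.Residues"
begin

text \<open>Two elements are adjacent or equal in the enhanced power graph iff they lie in a common cyclic
  subgroup. In the quaternion group \<open>Q\<close>, and in its product with a cyclic group of odd order, deleting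
  the dominating vertices leaves \<open>2^(k-2) + 1\<close> cliques, one for each maximal cyclic subgroup of \<open>Q\<close>
  (a \<^emph>\<open>ray\<close>), and every clique needs two vertices of a total dominating set.

  For each prime \<open>q\<close>, an element of \<open>G1\<close> generates a cyclic group with at most one subgroup of order \<open>q\<close>
  (again a ray), and elements of a common cyclic subgroup cannot have different rays for the same
  index. Rays can be prescribed independently for all indices, since elements of coprime orders of
  \<open>G1\<close> commute. Let \<open>c\<close> be the least number of rays over all indices. If a total dominating set has
  at most \<open>c\<close> elements, charge each of them to one index where it has a ray; two adjacent elements
  charged to the same index block the same ray, so at every index some ray is not blocked, and an
  element with these unblocked rays has no neighbour in the set. Conversely, one representative for
  each ray of the best index, together with one element of the other factor, is a total dominating
  set. These representatives are not dominating vertices because a noncyclic \<open>p\<close>-group with \<open>p\<close> odd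
  has more than one subgroup of order \<open>p\<close>.\<close>

section \<open>Cyclic subgroups of a group\<close>

context group
begin

lemma int_pow_in_generate: "w \<in> carrier G \<Longrightarrow> w [^] (i::int) \<in> generate G {w}"
  using generate_pow by auto

lemma nat_pow_in_generate: "w \<in> carrier G \<Longrightarrow> w [^] (i::nat) \<in> generate G {w}"
  using int_pow_in_generate[of w "int i"] by (simp add: int_pow_int)

lemma generate_singleton_carrier: "w \<in> carrier G \<Longrightarrow> generate G {w} \<subseteq> carrier G"
  by (simp add: generate_incl)

lemma generate_singleton_mono:
  assumes "w \<in> carrier G" "u \<in> generate G {w}"
  shows "generate G {u} \<subseteq> generate G {w}"
  using generate_subgroup_incl[of "{u}" "generate G {w}"] generate_is_subgroup[of "{w}"] assms by simp

lemma subgroup_pow_card: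
  assumes "subgroup H G" "h \<in> H"
  shows "h [^] card H = \<one>"
  using group.pow_order_eq_1[OF subgroup_imp_group[OF assms(1)], of h] assms(2)
  by (simp add: order_def nat_pow_consistent[symmetric])

lemma prime_card_subgroup_generate:
  assumes "subgroup H G" "card H = q" "prime q" "h \<in> H" "h \<noteq> \<one>"
  shows "ord h = q" "generate G {h} = H"
proof -
  have h: "h \<in> carrier G" using assms(1,4) by (rule subgroup.mem_carrier)
  have "ord h dvd q" using subgroup_pow_card[OF assms(1,4)] assms(2) h pow_eq_id by simp
  then show o: "ord h = q" using assms(3,5) ord_eq_1[OF h] prime_nat_iff by blast
  have fin: "finite H" using assms(2,3) prime_gt_0_nat by (metis card.infinite less_irrefl)
  have "generate G {h} \<subseteq> H" using generate_subgroup_incl[of "{h}" H] assms by simp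
  moreover have "card (generate G {h}) = card H" using generate_pow_card[OF h] o assms(2) by simp
  ultimately show "generate G {h} = H" using fin card_subset_eq by blast
qed

lemma prime_card_subgroup_nontrivial:
  assumes "subgroup H G" "card H = q" "prime q"
  obtains h where "h \<in> H" "h \<noteq> \<one>" "h \<in> carrier G"
proof -
  have "\<not> H \<subseteq> {\<one>}"
    using card_mono[of "{\<one>}" H] assms prime_gt_1_nat[of q] by auto
  then show ?thesis using that subgroup.mem_carrier[OF assms(1)] by blast
qed

text \<open>A generator of \<open>H\<close> is \<open>w [^] i\<close>, and its \<open>q\<close>-th
  power is trivial, so \<open>i\<close> is a multiple of \<open>ord w div q\<close>; counting turns
  the inclusion into an equality. Hence a finite cyclic group has at most one subgroup of order
  \<open>q\<close>, which makes rays well defined. The value 0 of \<open>ord\<close> would mean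
  infinite order.\<close>

lemma prime_card_subgroup_in_cyclic:
  assumes w: "w \<in> carrier G" "ord w \<noteq> 0" and H: "subgroup H G" "card H = q" "prime q"
    and "H \<subseteq> generate G {w}"
  shows "q dvd ord w" "H = generate G {w [^] (ord w div q)}"
proof -
  obtain h where h: "h \<in> H" "h \<noteq> \<one>" "h \<in> carrier G"
    using prime_card_subgroup_nontrivial[OF H] .
  note oh = prime_card_subgroup_generate[OF H h(1,2)]
  obtain i :: int where i: "h = w [^] i" using h(1) assms(6) generate_pow[OF w(1)] by blast
  have "h [^] ord w = (w [^] i) [^] int (ord w)" by (simp add: i int_pow_int)
  also have "\<dots> = \<one>" using w(1) by (simp add: int_pow_pow int_pow_eq_id)
  finally show q: "q dvd ord w" using oh(1) h(3) pow_eq_id by simp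
  then obtain N where N: "ord w = q * N" by blast
  have q0: "q > 0" using H(3) prime_gt_0_nat by blast
  have "w [^] (i * int q) = h [^] q" using w(1) i by (simp add: int_pow_pow[symmetric] int_pow_int)
  also have "\<dots> = \<one>" using oh(1) h(3) pow_ord_eq_1 by blast
  finally have "int (ord w) dvd i * int q" using w(1) int_pow_eq_id by blast
  then have "int N dvd i" using N q0 by (simp add: mult.commute)
  then obtain j where "i = int N * j" by blast
  then have "h = (w [^] N) [^] j" using i w(1) by (simp add: int_pow_int[symmetric] int_pow_pow)
  then have "h \<in> generate G {w [^] N}" using int_pow_in_generate[of "w [^] N" j] w(1) by simp
  then have sub: "H \<subseteq> generate G {w [^] N}"
    using generate_singleton_mono[of "w [^] N" h] w(1) oh(2) by simp
  have "ord (w [^] N) = q" using ord_pow[OF w(1), of N] N w(2) by auto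
  then have card: "card (generate G {w [^] N}) = card H"
    using generate_pow_card[of "w [^] N"] w(1) H(2) by simp
  then have "finite (generate G {w [^] N})" using H(2) q0 card_ge_0_finite by metis
  then have "H = generate G {w [^] N}" using sub card card_subset_eq by metis
  then show "H = generate G {w [^] (ord w div q)}" using N q0 by simp
qed

lemma cyclic_prime_card_subgroup:
  assumes "w \<in> carrier G" "ord w \<noteq> 0" "prime q" "q dvd ord w"
  shows "subgroup (generate G {w [^] (ord w div q)}) G"
    "card (generate G {w [^] (ord w div q)}) = q"
    "generate G {w [^] (ord w div q)} \<subseteq> generate G {w}"
proof -
  show "subgroup (generate G {w [^] (ord w div q)}) G"
    using generate_is_subgroup[of "{w [^] (ord w div q)}"] assms(1) by simp
  show "generate G {w [^] (ord w div q)} \<subseteq> generate G {w}"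
    using generate_singleton_mono[OF assms(1) nat_pow_in_generate[OF assms(1)]] .
  have "ord (w [^] (ord w div q)) = q"
    using ord_pow[OF assms(1), of "ord w div q"] assms(2-4) by (metis div_dvd_iff_mult dvd_div_eq_0_iff dvd_div_eq_mult dvd_triv_left dvd_mult_div_cancel mult_eq_0_iff nonzero_mult_div_cancel_right)
  then show "card (generate G {w [^] (ord w div q)}) = q"
    using generate_pow_card[of "w [^] (ord w div q)"] assms(1) by simp
qed

text \<open>By Bezout some exponent is divisible by \<open>N\<close> and is 1 modulo
  \<open>M\<close>; raising \<open>a \<otimes> b\<close> to it kills \<open>b\<close> and leaves
  \<open>a\<close>.\<close>

lemma coprime_commuting_in_generate:
  assumes "a \<in> carrier G" "b \<in> carrier G" "a \<otimes> b = b \<otimes> a"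
    and "a [^] (M::nat) = \<one>" "b [^] (N::nat) = \<one>" "coprime M N"
  shows "a \<in> generate G {a \<otimes> b}" "b \<in> generate G {a \<otimes> b}"
proof -
  \<comment> \<open>Stated for arbitrary elements and exponents because the second claim is the same
    with the roles exchanged.\<close>
  have *: "a \<in> generate G {a \<otimes> b}"
    if ab: "a \<in> carrier G" "b \<in> carrier G" "a \<otimes> b = b \<otimes> a" "a [^] (M::nat) = \<one>" "b [^] (N::nat) = \<one>"
      and MN: "coprime M N"
    for a b M N
  proof -
    obtain x y where xy: "int M * x + int N * y = 1"
      using bezout_int[of "int M" "int N"] MN by (metis coprime_imp_gcd_eq_1 coprime_int_iff mult.commute)
    have bN: "b [^] (int N * y) = \<one>"
      using ab by (simp add: int_pow_pow[symmetric] int_pow_int)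
    have aM: "a [^] (int M * x) = \<one>"
      using ab by (simp add: int_pow_pow[symmetric] int_pow_int)
    have "(a \<otimes> b) [^] (int N * y) = a [^] (int N * y) \<otimes> b [^] (int N * y)"
      using ab int_pow_mult_distrib by blast
    also have "\<dots> = a [^] (int M * x) \<otimes> a [^] (int N * y)" using ab(1) aM bN by simp
    also have "\<dots> = a" using ab(1) xy by (simp add: int_pow_mult[symmetric])
    finally show ?thesis using int_pow_in_generate[of "a \<otimes> b" "int N * y"] ab by simp
  qed
  show "a \<in> generate G {a \<otimes> b}" using * assms by blast
  show "b \<in> generate G {a \<otimes> b}" using *[of b a N M] assms by (metis coprime_commute)
qed

end

section \<open>Noncyclic p-groups of odd order\<close>

text \<open>Fermat's little theorem gives \<open>s = 1 + p * t\<close>, so \<open>s ^ i\<close> is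
  \<open>1 + p * t * i\<close> modulo \<open>p\<^sup>2\<close> and the sum is \<open>p\<close>
  modulo \<open>p\<^sup>2\<close>. The sum occurs below as an exponent in the \<open>p\<close>-th
  power of \<open>a [^] i \<otimes> b\<close> and has to be divisible by \<open>p\<close> exactly
  once.\<close>

lemma sum_powers_prime:
  fixes p s :: nat
  assumes "prime p" "odd p" "[s ^ p = 1] (mod p)"
  obtains u where "(\<Sum>t<p. s ^ t) = p * u" "coprime u p"
proof -
  have p1: "p > 1" using assms(1) prime_gt_1_nat by blast
  have "[s = 1] (mod p)"
  proof (cases "p dvd s")
    case True
    then have "[s ^ p = 0] (mod p)" using p1 by (simp add: cong_0_iff dvd_power_same prime_dvd_power_nat_iff[OF assms(1)])
    then have "[0 = 1] (mod p)" using assms(3) cong_sym cong_trans by blast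
    then show ?thesis using p1 by (simp add: cong_def)
  next
    case False
    have "[s ^ (p - 1) * s = 1 * s] (mod p)"
      using fermat_theorem[OF assms(1) False] cong_mult cong_refl by blast
    moreover have "s ^ (p - 1) * s = s ^ p" using p1 by (metis power_minus_mult gr_implies_not0 neq0_conv)
    ultimately show ?thesis using assms(3) cong_sym cong_trans by (metis mult_1)
  qed
  then have "s mod p = 1" using p1 by (simp add: cong_def)
  then obtain t where t: "s = 1 + p * t" by (metis mod_mult_div_eq add.commute)
  have "\<exists>c. s ^ i = 1 + p * t * i + p\<^sup>2 * c" for i
  proof (induction i)
    case (Suc i)
    then obtain c where "s ^ i = 1 + p * t * i + p\<^sup>2 * c" by blast
    then have "s ^ Suc i = 1 + p * t * Suc i + p\<^sup>2 * (t * t * i + c + p * t * c)"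
      by (simp add: t algebra_simps power2_eq_square)
    then show ?case by blast
  qed auto
  then obtain c where c: "\<And>i. s ^ i = 1 + p * t * i + p\<^sup>2 * c i" by metis
  have "2 * (\<Sum>i<p. i) = p * (p - 1)"
    using gauss_sum_nat[of "p - 1"] p1
    by (metis (no_types, lifting) Suc_pred' atLeast0AtMost lessThan_Suc_atMost dvd_mult_div_cancel even_Suc even_mult_iff
        le_less_trans mult.commute zero_le)
  \<comment> \<open>Oddness of \<open>p\<close> enters here: it makes the sum of all
    \<open>i < p\<close> a multiple of \<open>p\<close>. For \<open>p = 2\<close> and
    \<open>s = 3\<close> the conclusion fails.\<close>
  moreover obtain m where m: "p - 1 = 2 * m" using assms(2) p1 by (metis oddE diff_add_inverse2)
  ultimately have S: "(\<Sum>i<p. i) = p * m" by simp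
  have "(\<Sum>i<p. s ^ i) = p + p * t * (\<Sum>i<p. i) + p\<^sup>2 * (\<Sum>i<p. c i)"
    by (simp add: c sum.distrib sum_distrib_left del: One_nat_def plus_1_eq_Suc)
  also have "\<dots> = p * (1 + p * (t * m + (\<Sum>i<p. c i)))"
    by (simp add: S algebra_simps power2_eq_square)
  finally have "(\<Sum>i<p. s ^ i) = p * (1 + p * (t * m + (\<Sum>i<p. c i)))" .
  moreover have "coprime (1 + p * (t * m + (\<Sum>i<p. c i))) p"
    by (metis coprime_1_left coprime_iff_gcd_eq_1 gcd.commute gcd_add_mult add.commute mult.commute)
  ultimately show thesis using that by blast
qed

context group
begin

lemma generate_eq_nat_pow:
  assumes "finite (carrier G)" "a \<in> carrier G"
  shows "generate G {a} = range (\<lambda>i::nat. a [^] i)"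
  using generate_pow_on_finite_carrier[OF assms] by auto

section \<open>Powers of products in which one factor normalizes the other\<close>

lemma conj_nat_pow:
  assumes "a \<in> carrier G" "b \<in> carrier G" "b \<otimes> a = a [^] (s::nat) \<otimes> b"
  shows "b \<otimes> a [^] (i::nat) = a [^] (i * s) \<otimes> b"
proof (induction i)
  case (Suc i)
  have "b \<otimes> a [^] Suc i = (b \<otimes> a [^] i) \<otimes> a" using assms by (simp add: m_assoc)
  also have "\<dots> = a [^] (i * s) \<otimes> (b \<otimes> a)" using assms Suc by (simp add: m_assoc)
  also have "\<dots> = a [^] (Suc i * s) \<otimes> b"
    using assms by (simp add: m_assoc[symmetric] nat_pow_mult add.commute)
  finally show ?case .
qed (use assms in simp)

lemma pow_conj_nat_pow:
  assumes "a \<in> carrier G" "b \<in> carrier G" "b \<otimes> a = a [^] (s::nat) \<otimes> b"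
  shows "b [^] (m::nat) \<otimes> a [^] (i::nat) = a [^] (i * s ^ m) \<otimes> b [^] m"
proof (induction m arbitrary: i)
  case (Suc m)
  have "b [^] Suc m \<otimes> a [^] i = b [^] m \<otimes> (b \<otimes> a [^] i)" using assms by (simp add: m_assoc)
  also have "\<dots> = (b [^] m \<otimes> a [^] (i * s)) \<otimes> b"
    using assms conj_nat_pow[OF assms] by (simp add: m_assoc)
  also have "\<dots> = a [^] (i * s ^ Suc m) \<otimes> b [^] Suc m"
    using assms Suc by (simp add: m_assoc mult.assoc)
  finally show ?case .
qed (use assms in simp)

text \<open>Each \<open>b\<close> moved to the right past a power of \<open>a\<close> multiplies the
  exponent by \<open>s\<close>, which produces a geometric sum.\<close>

lemma pow_mult_normalizing:
  assumes "a \<in> carrier G" "b \<in> carrier G" "b \<otimes> a = a [^] (s::nat) \<otimes> b"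
  shows "(a [^] (i::nat) \<otimes> b) [^] (m::nat) = a [^] (i * (\<Sum>t<m. s ^ t)) \<otimes> b [^] m"
proof (induction m)
  case (Suc m)
  have "(a [^] i \<otimes> b) [^] Suc m = a [^] (i * (\<Sum>t<m. s ^ t)) \<otimes> (b [^] m \<otimes> a [^] i) \<otimes> b"
    using assms Suc by (simp add: m_assoc)
  also have "\<dots> = (a [^] (i * (\<Sum>t<m. s ^ t)) \<otimes> a [^] (i * s ^ m)) \<otimes> (b [^] m \<otimes> b)"
    using assms by (simp add: pow_conj_nat_pow[OF assms] m_assoc)
  also have "\<dots> = a [^] (i * (\<Sum>t<Suc m. s ^ t)) \<otimes> b [^] Suc m"
    using assms by (simp add: nat_pow_mult algebra_simps)
  finally show ?case .
qed (use assms in simp)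

section \<open>Growing normalizers and a second subgroup of order p\<close>

text \<open>Take \<open>i\<close> such that the \<open>i\<close>-th term of the lower central series
  meets \<open>P\<close> outside \<open>A\<close> while the next term does not. For \<open>b\<close>
  in that part, the commutators of \<open>b\<close> with elements of \<open>A\<close> lie in the
  next term and in \<open>P\<close>, hence in \<open>A\<close>.\<close>

lemma nilpotent_normalizer_grows:
  assumes "nilpotent_group G" "subgroup P G" "subgroup A G" "A \<subset> P"
  obtains b where "b \<in> P - A" "\<And>a. a \<in> A \<Longrightarrow> b \<otimes> a \<otimes> inv b \<in> A"
proof -
  obtain c where c: "lower_central_series G c = {\<one>}"
    using assms(1) unfolding nilpotent_group_def by blast
  let ?Q = "\<lambda>i. lower_central_series G i \<inter> P \<subseteq> A"
  have "?Q c" using c subgroup.one_closed[OF assms(3)] by auto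
  define j where "j = (LEAST i. ?Q i)"
  have j: "?Q j" unfolding j_def using \<open>?Q c\<close> by (rule LeastI)
  \<comment> \<open>Term 0 is the whole group and \<open>P\<close> is not contained in
    \<open>A\<close>, so the least index is a successor.\<close>
  have "\<not> ?Q 0" using assms(4) subgroup.subset[OF assms(2)] by auto
  with j obtain i where i: "j = Suc i" by (cases j) metis+
  then have "\<not> ?Q i" using not_less_Least[of i ?Q] j_def by simp
  then obtain b where b: "b \<in> lower_central_series G i" "b \<in> P" "b \<notin> A" by blast
  have bc: "b \<in> carrier G" using subgroup.mem_carrier[OF assms(2) b(2)] .
  have "b \<otimes> a \<otimes> inv b \<in> A" if a: "a \<in> A" for a
  proof -
    have ac: "a \<in> carrier G" using subgroup.mem_carrier[OF assms(3) a] .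
    have aP: "a \<in> P" using a assms(4) by blast
    have "b \<otimes> a \<otimes> inv b \<otimes> inv a \<in> lower_central_series G j"
      unfolding i lower_central_series.simps
      by (rule generate.incl) (use b(1) ac in blast)
    moreover have "b \<otimes> a \<otimes> inv b \<otimes> inv a \<in> P"
      using subgroup.m_closed[OF assms(2)] subgroup.m_inv_closed[OF assms(2)] b(2) aP by simp
    ultimately have "b \<otimes> a \<otimes> inv b \<otimes> inv a \<in> A" using j by blast
    then have "b \<otimes> a \<otimes> inv b \<otimes> inv a \<otimes> a \<in> A"
      using subgroup.m_closed[OF assms(3)] a by blast
    then show ?thesis using ac bc by (simp add: m_assoc)
  qed
  then show thesis using that b by blast
qed

text \<open>One subgroup lies in the cyclic group \<open>A\<close> generated by an element of
  maximal order; the other is generated by an element of order \<open>p\<close> outside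
  \<open>A\<close>. Oddness is essential: a generalized quaternion group has a single
  involution.\<close>

lemma odd_p_group_two_subgroups:
  assumes "finite (carrier G)" "nilpotent_group G" "subgroup P G" "card P = p ^ e"
    and p: "prime p" "odd p" and noncyclic: "\<And>a. a \<in> P \<Longrightarrow> generate G {a} \<noteq> P"
  shows "\<exists>H K. subgroup H G \<and> subgroup K G \<and> H \<subseteq> P \<and> K \<subseteq> P \<and> card H = p \<and> card K = p \<and> H \<noteq> K"
proof -
  have Pc: "P \<subseteq> carrier G" using assms(3) by (rule subgroup.subset)
  have finP: "finite P" using Pc assms(1) finite_subset by blast
  have oneP: "\<one> \<in> P" using assms(3) by (rule subgroup.one_closed)
  have p1: "p > 1" using p(1) prime_gt_1_nat by blast
  have ordP: "ord x dvd p ^ e" if "x \<in> P" for x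
    using subgroup_pow_card[OF assms(3) that] that Pc assms(4) pow_eq_id by auto
  have "Max (ord ` P) \<in> ord ` P" using finP oneP by (intro Max_in) auto
  then obtain a where a: "a \<in> P" "ord a = Max (ord ` P)" by auto
  have max: "ord x \<le> ord a" if "x \<in> P" for x using a(2) finP that by simp
  have ac: "a \<in> carrier G" using a(1) Pc by blast
  define A where "A = generate G {a}"
  have A: "subgroup A G" unfolding A_def using generate_is_subgroup ac by simp
  have AP: "A \<subset> P"
    using generate_subgroup_incl[of "{a}" P] assms(3) a(1) noncyclic[OF a(1)] A_def by blast
  have A_eq: "A = range (\<lambda>i::nat. a [^] i)" unfolding A_def using generate_eq_nat_pow assms(1) ac by blast
  obtain n where n: "ord a = p ^ n" using ordP[OF a(1)] p(1) divides_primepow_nat by blast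
  have n0: "n > 0"
  proof (rule ccontr)
    assume "\<not> n > 0"
    then have "ord x \<le> 1" if "x \<in> P" for x using max[OF that] n by simp
    then have "x = \<one>" if "x \<in> P" for x
      using that ord_eq_1[of x] ord_ge_1[OF assms(1), of x] Pc by force
    then show False using AP subgroup.one_closed[OF A] by blast
  qed
  \<comment> \<open>Orders in \<open>P\<close> are powers of \<open>p\<close>, so by maximality of
    \<open>ord a\<close> all of them divide \<open>p ^ n\<close>.\<close>
  have ord_dvd: "x [^] (p ^ n) = \<one>" if x: "x \<in> P" for x
  proof -
    obtain l where l: "ord x = p ^ l" using ordP[OF x] p(1) divides_primepow_nat by blast
    then have "l \<le> n" using max[OF x] n p1 by simp
    then have "ord x dvd p ^ n" using l le_imp_power_dvd by simp
    then show ?thesis using x Pc pow_eq_id by auto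
  qed
  \<comment> \<open>An element \<open>b\<close> normalizing \<open>\<langle>a\<rangle>\<close>, with \<open>b\<^sup>p \<in> \<langle>a\<rangle>\<close>, is multiplied by a power of \<open>a\<close> so that its
    \<open>p\<close>-th power becomes trivial; here the maximality of the order of \<open>a\<close> is used.\<close>
  obtain b0 where b0: "b0 \<in> P - A" "\<And>x. x \<in> A \<Longrightarrow> b0 \<otimes> x \<otimes> inv b0 \<in> A"
    using nilpotent_normalizer_grows[OF assms(2,3) A AP] by blast
  have b0c: "b0 \<in> carrier G" using b0(1) Pc by blast
  \<comment> \<open>With \<open>l\<close> least, \<open>b0 [^] (p ^ (l - 1))\<close> lies outside
    \<open>A\<close> and its \<open>p\<close>-th power inside.\<close>
  define l where "l = (LEAST l. b0 [^] (p ^ l) \<in> A)"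
  have "b0 [^] (p ^ n) \<in> A" using ord_dvd b0(1) subgroup.one_closed[OF A] by simp
  then have lA: "b0 [^] (p ^ l) \<in> A" unfolding l_def by (rule LeastI)
  have "l \<noteq> 0" using lA b0 b0c by (metis DiffD2 nat_pow_eone power_0)
  then obtain l' where l': "l = Suc l'" by (cases l) auto
  define b where "b = b0 [^] (p ^ l')"
  have bA: "b \<notin> A" unfolding b_def using not_less_Least[of l' "\<lambda>l. b0 [^] (p ^ l) \<in> A"] l' l_def by simp
  have "b0 [^] i \<in> P" for i :: nat using monoid.nat_pow_closed[OF group.is_monoid[OF subgroup_imp_group[OF assms(3)]], of b0 i] b0(1)
    by (simp add: nat_pow_consistent[symmetric])
  then have bP: "b \<in> P" unfolding b_def by blast
  have bc: "b \<in> carrier G" using bP Pc by blast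
  have bp: "b [^] p \<in> A" unfolding b_def using lA b0c by (simp add: nat_pow_pow l' mult.commute)
  obtain s0 where "b0 \<otimes> a \<otimes> inv b0 = a [^] (s0::nat)"
    using b0(2)[of a] A_eq A_def ac generate.incl by (metis (no_types, lifting) imageE singletonI)
  then have "b0 \<otimes> a = a [^] s0 \<otimes> b0" using ac b0c by (metis inv_solve_right m_closed nat_pow_closed)
  then have "b \<otimes> a [^] (1::nat) = a [^] (1 * s0 ^ (p ^ l')) \<otimes> b"
    unfolding b_def using pow_conj_nat_pow[OF ac b0c] by blast
  then obtain s :: nat where s: "b \<otimes> a = a [^] s \<otimes> b" using ac by auto
  obtain j :: nat where j: "b [^] p = a [^] j" using bp A_eq by blast
  have pn: "p ^ n = p * p ^ (n - 1)" using n0 by (simp add: power_eq_if)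
  \<comment> \<open>\<open>b [^] (p ^ n)\<close> is trivial, so \<open>p ^ n\<close> divides
    \<open>j * p ^ (n - 1)\<close>; thus \<open>b [^] p\<close> is the \<open>p\<close>-th power of
    an element of \<open>A\<close>.\<close>
  have "a [^] (j * p ^ (n - 1)) = b [^] (p * p ^ (n - 1))" using j ac bc nat_pow_pow by metis
  also have "\<dots> = \<one>" using ord_dvd[OF bP] pn by simp
  finally have "p * p ^ (n - 1) dvd j * p ^ (n - 1)" using ac pow_eq_id n pn by simp
  then have "p dvd j" using p1 by simp
  then obtain j' where j': "j = p * j'" by blast
  \<comment> \<open>\<open>b [^] p\<close> is a power of \<open>a\<close> and commutes with it,
    while conjugation by it sends \<open>a\<close> to \<open>a [^] (s ^ p)\<close>; hence
    \<open>s ^ p\<close> is 1 modulo \<open>p ^ n\<close>.\<close>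
  have "a [^] (s ^ p) \<otimes> b [^] p = b [^] p \<otimes> a" using pow_conj_nat_pow[OF ac bc s, of p 1] ac by simp
  also have "\<dots> = a \<otimes> b [^] p" unfolding j using ac by (metis nat_pow_Suc nat_pow_Suc2)
  finally have "a [^] (s ^ p) = a [^] (1::nat)" using ac bc by simp
  then have "int (p ^ n) dvd int (s ^ p) - 1" using int_pow_eq[OF ac, of 1 "int (s ^ p)"] ac n
    by (simp add: int_pow_int del: of_nat_power)
  moreover have "int p dvd int (p ^ n)" by (simp add: pn)
  ultimately have "int p dvd int (s ^ p) - int 1" using dvd_trans by (metis of_nat_1)
  then have "[s ^ p = 1] (mod p)" by (metis cong_iff_dvd_diff cong_int_iff)
  then obtain u where u: "(\<Sum>t<p. s ^ t) = p * u" "coprime u p" using sum_powers_prime[OF p] by blast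
  have "coprime u (p ^ n)" using u(2) by simp
  then obtain v where "[u * v = Suc 0] (mod p ^ n)" using cong_solve_coprime_nat by blast
  then have "[u * v = 1] (mod p ^ n)" by simp
  then have v: "[u * v * (j' * (p ^ n - 1)) = 1 * (j' * (p ^ n - 1))] (mod p ^ n)" by (rule cong_mult) simp
  \<comment> \<open>\<open>i\<close> is \<open>- j' / u\<close> modulo \<open>p ^ n\<close>:
    \<open>v\<close> inverts \<open>u\<close>, and \<open>p ^ n - 1\<close> stands for -1. This
    makes \<open>i * u + j'\<close> a multiple of \<open>p ^ n\<close>, which suffices for
    \<open>d [^] p\<close> to be trivial.\<close>
  define i where "i = v * (j' * (p ^ n - 1))"
  have "[i * u + j' = j' * (p ^ n - 1) + j'] (mod p ^ n)"
    using v unfolding i_def by (intro cong_add cong_refl) (simp add: mult_ac)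
  moreover have "j' * (p ^ n - 1) + j' = j' * p ^ n" using p1 by (simp add: algebra_simps)
  ultimately have "[i * u + j' = 0] (mod p ^ n)" by (metis cong_mult_self_right cong_trans)
  then have iu: "p ^ n dvd i * u + j'" by (simp add: cong_0_iff)
  define d where "d = a [^] i \<otimes> b"
  have "d [^] p = a [^] (i * (p * u)) \<otimes> a [^] (p * j')"
    unfolding d_def pow_mult_normalizing[OF ac bc s] u(1) j j' ..
  also have "\<dots> = a [^] (p * (i * u + j'))" using ac by (simp add: nat_pow_mult algebra_simps)
  also have "\<dots> = \<one>" using ac pow_eq_id n iu by (simp add: dvd_mult)
  finally have dp: "d [^] p = \<one>" .
  have aiA: "a [^] i \<in> A" using A_eq by blast
  have dA: "d \<notin> A"
  proof
    assume "d \<in> A"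
    then have "inv (a [^] i) \<otimes> d \<in> A" using aiA A subgroup.m_closed subgroup.m_inv_closed by metis
    then show False using bA ac bc unfolding d_def by (simp add: m_assoc[symmetric])
  qed
  have dP: "d \<in> P" unfolding d_def using aiA AP bP subgroup.m_closed[OF assms(3)] by blast
  have dc: "d \<in> carrier G" using dP Pc by blast
  have "ord d dvd p" using dp dc pow_eq_id by simp
  moreover have "ord d \<noteq> 1" using dA subgroup.one_closed[OF A] ord_eq_1[OF dc] by metis
  ultimately have od: "ord d = p" using p(1) prime_nat_iff by blast
  have opa: "ord a \<noteq> 0" using n p1 by simp
  have "p dvd ord a" by (simp add: n pn)
  note C = cyclic_prime_card_subgroup[OF ac opa p(1) this]
  have "subgroup (generate G {d}) G" using generate_is_subgroup dc by simp
  moreover have "card (generate G {d}) = p" using generate_pow_card[OF dc] od by simp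
  moreover have "generate G {d} \<subseteq> P" using generate_subgroup_incl[of "{d}" P] assms(3) dP by simp
  moreover have "generate G {d} \<noteq> generate G {a [^] (ord a div p)}"
    using C(3) dA A_def generate.incl[of d "{d}" G] by blast
  moreover have "generate G {a [^] (ord a div p)} \<subseteq> P" using C(3) AP A_def by blast
  ultimately show ?thesis using C(1,2) by blast
qed

end

section \<open>Total domination in proper enhanced power graphs\<close>

text \<open>On the carrier this is adjacency or equality in the enhanced power graph. Without the
  distinctness it is reflexive and preserved by homomorphisms.\<close>

definition joint_cyclic :: "('a, 'b) monoid_scheme \<Rightarrow> 'a \<Rightarrow> 'a \<Rightarrow> bool"
  where "joint_cyclic G u v \<longleftrightarrow>
    (\<exists>w \<in> carrier G. u \<in> generate G {w} \<and> v \<in> generate G {w})"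

lemma joint_cyclic_sym: "joint_cyclic G u v \<Longrightarrow> joint_cyclic G v u"
  unfolding joint_cyclic_def by blast

lemma (in group) joint_cyclic_if_mem_generate:
  "v \<in> carrier G \<Longrightarrow> u \<in> generate G {v} \<Longrightarrow> joint_cyclic G u v"
  unfolding joint_cyclic_def by (meson generate.incl singletonI)

lemma (in group) joint_cyclic_refl: "u \<in> carrier G \<Longrightarrow> joint_cyclic G u u"
  by (simp add: joint_cyclic_if_mem_generate generate.incl)

lemma (in group) joint_cyclic_one: "u \<in> carrier G \<Longrightarrow> joint_cyclic G \<one> u"
  by (simp add: joint_cyclic_if_mem_generate generate.one)

lemma (in group) joint_cyclic_coprime:
  assumes "a \<in> carrier G" "b \<in> carrier G" "a \<otimes> b = b \<otimes> a" "coprime (ord a) (ord b)"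
  shows "joint_cyclic G a b"
  using coprime_commuting_in_generate[OF assms(1-3) _ _ assms(4)] assms(1,2)
  unfolding joint_cyclic_def by (metis m_closed pow_ord_eq_1)

lemma (in group_hom) joint_cyclic_image:
  assumes "joint_cyclic G u v"
  shows "joint_cyclic H (h u) (h v)"
proof -
  obtain w where w: "w \<in> carrier G" "u \<in> generate G {w}" "v \<in> generate G {w}"
    using assms unfolding joint_cyclic_def by blast
  then have "generate H {h w} = h ` generate G {w}" using generate_img[of "{w}"] by simp
  then have "h u \<in> generate H {h w}" "h v \<in> generate H {h w}" using w(2,3) by simp_all
  then show ?thesis using hom_closed[OF w(1)] unfolding joint_cyclic_def by blast
qed

lemma adjacent_enhanced_power_graph:
  "adjacent (enhanced_power_graph G) u v \<longleftrightarrow>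
    u \<in> carrier G \<and> v \<in> carrier G \<and> u \<noteq> v \<and> joint_cyclic G u v"
  unfolding adjacent_def enhanced_power_graph_def joint_cyclic_def
  by (auto simp: doubleton_eq_iff)

lemma (in group) verts_proper_enhanced_power_graph:
  "verts (proper_enhanced_power_graph G) = {u \<in> carrier G. \<exists>v \<in> carrier G. \<not> joint_cyclic G u v}"
proof -
  have "verts (enhanced_power_graph G) = carrier G" by (simp add: enhanced_power_graph_def)
  then show ?thesis
    unfolding proper_enhanced_power_graph_def delete_vertices_def dominating_vertices_def
    using joint_cyclic_refl by (auto simp: adjacent_enhanced_power_graph)
qed

lemma adjacent_proper_enhanced_power_graph:
  "adjacent (proper_enhanced_power_graph G) u v \<longleftrightarrow>
    u \<in> verts (proper_enhanced_power_graph G) \<and> v \<in> verts (proper_enhanced_power_graph G) \<and>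
    u \<noteq> v \<and> joint_cyclic G u v"
proof -
  have "verts (proper_enhanced_power_graph G) = carrier G - dominating_vertices (enhanced_power_graph G)"
    by (simp add: proper_enhanced_power_graph_def delete_vertices_def enhanced_power_graph_def)
  moreover have "adjacent (proper_enhanced_power_graph G) u v \<longleftrightarrow> adjacent (enhanced_power_graph G) u v \<and>
      u \<notin> dominating_vertices (enhanced_power_graph G) \<and> v \<notin> dominating_vertices (enhanced_power_graph G)"
    unfolding adjacent_def proper_enhanced_power_graph_def delete_vertices_def by auto
  ultimately show ?thesis by (auto simp: adjacent_enhanced_power_graph)
qed

section \<open>Invariance of the strong domination number under isomorphism\<close>

lemma total_dominating_set_image:
  assumes f: "bij_betw f (verts \<Gamma>) (verts \<Delta>)"
    and adj: "\<And>u v. u \<in> verts \<Gamma> \<Longrightarrow> v \<in> verts \<Gamma> \<Longrightarrow> adjacent \<Gamma> u v \<longleftrightarrow> adjacent \<Delta> (f u) (f v)"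
    and D: "total_dominating_set \<Gamma> D"
  shows "total_dominating_set \<Delta> (f ` D)" "card (f ` D) = card D"
proof -
  have DV: "D \<subseteq> verts \<Gamma>" using D unfolding total_dominating_set_def by blast
  show "card (f ` D) = card D"
    using f DV by (meson bij_betw_def card_image inj_on_subset)
  show "total_dominating_set \<Delta> (f ` D)"
    unfolding total_dominating_set_def
  proof (intro conjI ballI)
    show "f ` D \<subseteq> verts \<Delta>" using DV f bij_betw_imp_surj_on by blast
    fix y assume "y \<in> verts \<Delta>"
    then obtain u where u: "u \<in> verts \<Gamma>" "y = f u" using f bij_betw_imp_surj_on by blast
    then obtain v where "v \<in> D" "adjacent \<Gamma> u v" using D unfolding total_dominating_set_def by blast
    then show "\<exists>v\<in>f ` D. adjacent \<Delta> y v" using adj u DV by blast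
  qed
qed

lemma strong_domination_number_iso:
  assumes f: "bij_betw f (verts \<Gamma>) (verts \<Delta>)"
    and adj: "\<And>u v. u \<in> verts \<Gamma> \<Longrightarrow> v \<in> verts \<Gamma> \<Longrightarrow> adjacent \<Gamma> u v \<longleftrightarrow> adjacent \<Delta> (f u) (f v)"
  shows "strong_domination_number \<Gamma> = strong_domination_number \<Delta>"
proof -
  let ?g = "inv_into (verts \<Gamma>) f"
  have g: "bij_betw ?g (verts \<Delta>) (verts \<Gamma>)" using f by (rule bij_betw_inv_into)
  have "adjacent \<Delta> u v \<longleftrightarrow> adjacent \<Gamma> (?g u) (?g v)" if "u \<in> verts \<Delta>" "v \<in> verts \<Delta>" for u v
    using adj[of "?g u" "?g v"] that bij_betw_inv_into_right[OF f] bij_betwE[OF g] by simp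
  note g_image = total_dominating_set_image[OF g this]
  have "(\<exists>D. total_dominating_set \<Gamma> D \<and> finite D \<and> card D = c) \<longleftrightarrow>
    (\<exists>D. total_dominating_set \<Delta> D \<and> finite D \<and> card D = c)" for c
    using total_dominating_set_image[OF f adj] g_image by (metis finite_imageI)
  then show ?thesis unfolding strong_domination_number_def by simp
qed

text \<open>An isomorphism and its inverse both preserve \<open>joint_cyclic\<close>, which
  determines the vertices and edges of the proper graph.\<close>

lemma strong_domination_number_proper_enhanced_power_graph_iso:
  assumes "group G" "group H" "G \<cong> H"
  shows "strong_domination_number (proper_enhanced_power_graph G) =
    strong_domination_number (proper_enhanced_power_graph H)"
proof -
  interpret G: group G by fact
  interpret H: group H by fact
  obtain f where f: "f \<in> iso G H" using assms(3) unfolding is_iso_def by blast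
  let ?g = "inv_into (carrier G) f"
  have g: "?g \<in> iso H G" using G.iso_set_sym[OF f] .
  have fb: "bij_betw f (carrier G) (carrier H)" using f unfolding iso_def by blast
  interpret f: group_hom G H f
    using f G.group_axioms H.group_axioms by (simp add: group_hom_def group_hom_axioms_def iso_def)
  interpret g: group_hom H G ?g
    using g G.group_axioms H.group_axioms by (simp add: group_hom_def group_hom_axioms_def iso_def)
  have jc: "joint_cyclic G u v \<longleftrightarrow> joint_cyclic H (f u) (f v)" if "u \<in> carrier G" "v \<in> carrier G" for u v
    using f.joint_cyclic_image[of u v] g.joint_cyclic_image[of "f u" "f v"] that
      bij_betw_inv_into_left[OF fb] by auto
  let ?V = "verts (proper_enhanced_power_graph G)" and ?W = "verts (proper_enhanced_power_graph H)"
  have "f ` ?V = ?W"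
  proof
    show "f ` ?V \<subseteq> ?W"
      unfolding G.verts_proper_enhanced_power_graph H.verts_proper_enhanced_power_graph
      using jc by fastforce
    show "?W \<subseteq> f ` ?V"
    proof
      fix y assume y: "y \<in> ?W"
      then obtain z where yz: "y \<in> carrier H" "z \<in> carrier H" "\<not> joint_cyclic H y z"
        unfolding H.verts_proper_enhanced_power_graph by blast
      then have "\<not> joint_cyclic G (?g y) (?g z)" "f (?g y) = y" "?g y \<in> carrier G" "?g z \<in> carrier G"
        using jc[of "?g y" "?g z"] bij_betw_inv_into_right[OF fb] g.hom_closed by auto
      then show "y \<in> f ` ?V" unfolding G.verts_proper_enhanced_power_graph by force
    qed
  qed
  moreover have VG: "?V \<subseteq> carrier G" unfolding G.verts_proper_enhanced_power_graph by blast
  then have inj: "inj_on f ?V" using fb by (meson bij_betw_def inj_on_subset)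
  ultimately have bij: "bij_betw f ?V ?W" by (simp add: bij_betw_def)
  then show ?thesis
  proof (rule strong_domination_number_iso)
    fix u v assume uv: "u \<in> ?V" "v \<in> ?V"
    then have "f u \<in> ?W" "f v \<in> ?W" using bij bij_betwE by blast+
    moreover have "f u = f v \<longleftrightarrow> u = v" using inj uv by (simp add: inj_on_eq_iff)
    ultimately show "adjacent (proper_enhanced_power_graph G) u v \<longleftrightarrow>
      adjacent (proper_enhanced_power_graph H) (f u) (f v)"
      using uv jc[of u v] VG by (auto simp: adjacent_proper_enhanced_power_graph)
  qed
qed

lemma strong_domination_number_eqI:
  assumes "total_dominating_set \<Gamma> D" "finite D" "card D \<le> c"
    and "\<And>D. total_dominating_set \<Gamma> D \<Longrightarrow> finite D \<Longrightarrow> c \<le> card D"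
  shows "strong_domination_number \<Gamma> = c"
  unfolding strong_domination_number_def
proof (rule Least_equality)
  show "\<exists>D. total_dominating_set \<Gamma> D \<and> finite D \<and> card D = c"
    using assms le_antisym by blast
qed (use assms(4) in blast)

text \<open>The pigeonhole argument of the lower bound: \<open>\<rho> i d\<close> is the ray of
  \<open>d\<close> at index \<open>i\<close>, and \<open>c\<close> picks a ray at each index. Every
  \<open>d\<close> is charged to one index where it has a ray, so \<open>c\<close> need only avoid
  it there. The pair \<open>u\<close>, \<open>v\<close> saves one: fewer than \<open>card D\<close>
  rays are blocked at each index, so \<open>card D\<close> rays suffice instead of
  \<open>card D + 1\<close>.\<close>

lemma exists_avoiding_choice:
  fixes \<rho> :: "'i \<Rightarrow> 'v \<Rightarrow> 'r option"
  assumes "finite D"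
    and covered: "\<And>d. d \<in> D \<Longrightarrow> \<exists>i\<in>I. \<rho> i d \<noteq> None"
    and uv: "u \<in> D" "v \<in> D" "u \<noteq> v"
      "\<And>i. i \<in> I \<Longrightarrow> \<rho> i u = None \<or> \<rho> i v = None \<or> \<rho> i u = \<rho> i v"
    and card: "\<And>i. i \<in> I \<Longrightarrow> card D \<le> card (R i)"
  obtains c where "\<And>i. i \<in> I \<Longrightarrow> c i \<in> R i"
    "\<And>d. d \<in> D \<Longrightarrow> \<exists>i\<in>I. \<rho> i d \<noteq> None \<and> \<rho> i d \<noteq> Some (c i)"
proof -
  obtain f where f: "\<And>d. d \<in> D \<Longrightarrow> f d \<in> I" "\<And>d. d \<in> D \<Longrightarrow> \<rho> (f d) d \<noteq> None"
    using covered by metis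
  have "\<exists>r\<in>R i. \<forall>d\<in>D. f d = i \<longrightarrow> \<rho> i d \<noteq> Some r" if i: "i \<in> I" for i
  proof -
    let ?B = "(\<lambda>d. the (\<rho> i d)) ` {d \<in> D. f d = i}"
    \<comment> \<open>If all of \<open>D\<close> is charged to \<open>i\<close>, then \<open>u\<close> and \<open>v\<close> block the same element of \<open>R i\<close>.\<close>
    have "\<exists>e\<in>D. ?B \<subseteq> (\<lambda>d. the (\<rho> i d)) ` (D - {e})"
    proof (cases "\<exists>e\<in>D. f e \<noteq> i")
      case False
      then have "\<rho> i u = \<rho> i v" using f(2)[of u] f(2)[of v] uv(1,2) uv(4)[OF i] by auto
      then have "the (\<rho> i u) \<in> (\<lambda>d. the (\<rho> i d)) ` (D - {u})" using uv(2,3) by simp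
      then have "?B \<subseteq> (\<lambda>d. the (\<rho> i d)) ` (D - {u})" by blast
      then show ?thesis using uv(1) by blast
    qed blast
    then obtain e where e: "e \<in> D" "?B \<subseteq> (\<lambda>d. the (\<rho> i d)) ` (D - {e})" by blast
    have "card ?B \<le> card ((\<lambda>d. the (\<rho> i d)) ` (D - {e}))"
      using e(2) assms(1) by (intro card_mono) auto
    also have "\<dots> \<le> card (D - {e})" using assms(1) by (intro card_image_le) auto
    also have "\<dots> < card D" using e(1) assms(1) by (rule card_Diff1_less[rotated])
    also have "\<dots> \<le> card (R i)" using card i .
    finally have "\<not> R i \<subseteq> ?B" using assms(1) card_mono[of ?B "R i"] by auto
    then obtain r where "r \<in> R i" "r \<notin> ?B" by blast
    then show ?thesis by force
  qed
  then obtain c where "\<And>i. i \<in> I \<Longrightarrow> c i \<in> R i"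
    "\<And>i d. i \<in> I \<Longrightarrow> d \<in> D \<Longrightarrow> f d = i \<Longrightarrow> \<rho> i d \<noteq> Some (c i)" by metis
  then show thesis using that[of c] f by metis
qed

section \<open>Enhanced power graphs of direct products\<close>

text \<open>The pairs formed by \<open>w1\<close> or \<open>w2\<close> and a trivial component
  commute and are killed by coprime exponents, so both are powers of their product
  \<open>(w1, w2)\<close>.\<close>

lemma DirProd_in_generate:
  assumes "group G" "group H" "finite (carrier G)" "finite (carrier H)"
    and co: "coprime (order G) (order H)"
    and w: "w1 \<in> carrier G" "w2 \<in> carrier H"
    and uv: "u \<in> generate G {w1}" "v \<in> generate H {w2}"
  shows "(u, v) \<in> generate (G \<times>\<times> H) {(w1, w2)}"
proof -
  interpret G: group G by fact
  interpret H: group H by fact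
  interpret P: group "G \<times>\<times> H" using DirProd_group G.group_axioms H.group_axioms by blast
  interpret i: group_hom G "G \<times>\<times> H" "\<lambda>g. (g, \<one>\<^bsub>H\<^esub>)"
    by unfold_locales (auto simp: hom_def)
  interpret j: group_hom H "G \<times>\<times> H" "\<lambda>h. (\<one>\<^bsub>G\<^esub>, h)"
    by unfold_locales (auto simp: hom_def)
  let ?a = "(w1, \<one>\<^bsub>H\<^esub>)" and ?b = "(\<one>\<^bsub>G\<^esub>, w2)"
  have ab: "?a \<in> carrier (G \<times>\<times> H)" "?b \<in> carrier (G \<times>\<times> H)" using w by simp_all
  have pow_a: "?a [^]\<^bsub>G \<times>\<times> H\<^esub> order G = \<one>\<^bsub>G \<times>\<times> H\<^esub>"
    by (simp only: i.hom_nat_pow[OF w(1), symmetric] G.pow_order_eq_1[OF w(1)] one_DirProd)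
  have pow_b: "?b [^]\<^bsub>G \<times>\<times> H\<^esub> order H = \<one>\<^bsub>G \<times>\<times> H\<^esub>"
    by (simp only: j.hom_nat_pow[OF w(2), symmetric] H.pow_order_eq_1[OF w(2)] one_DirProd)
  have prod: "?a \<otimes>\<^bsub>G \<times>\<times> H\<^esub> ?b = (w1, w2)" using w by simp
  have comm: "?a \<otimes>\<^bsub>G \<times>\<times> H\<^esub> ?b = ?b \<otimes>\<^bsub>G \<times>\<times> H\<^esub> ?a" using w by simp
  note in_gen = P.coprime_commuting_in_generate[OF ab comm pow_a pow_b co, unfolded prod]
  have wc: "(w1, w2) \<in> carrier (G \<times>\<times> H)" using w by simp
  have "generate (G \<times>\<times> H) {?a} = (\<lambda>g. (g, \<one>\<^bsub>H\<^esub>)) ` generate G {w1}"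
    using i.generate_img[of "{w1}"] w(1) by (simp only: image_insert image_empty) simp
  then have "(u, \<one>\<^bsub>H\<^esub>) \<in> generate (G \<times>\<times> H) {?a}" using uv(1) by simp
  then have u: "(u, \<one>\<^bsub>H\<^esub>) \<in> generate (G \<times>\<times> H) {(w1, w2)}"
    using P.generate_singleton_mono[OF wc in_gen(1)] by blast
  have "generate (G \<times>\<times> H) {?b} = (\<lambda>h. (\<one>\<^bsub>G\<^esub>, h)) ` generate H {w2}"
    using j.generate_img[of "{w2}"] w(2) by (simp only: image_insert image_empty) simp
  then have "(\<one>\<^bsub>G\<^esub>, v) \<in> generate (G \<times>\<times> H) {?b}" using uv(2) by simp
  then have v: "(\<one>\<^bsub>G\<^esub>, v) \<in> generate (G \<times>\<times> H) {(w1, w2)}"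
    using P.generate_singleton_mono[OF wc in_gen(2)] by blast
  have "u \<in> carrier G" "v \<in> carrier H"
    using uv w G.generate_singleton_carrier H.generate_singleton_carrier by blast+
  then have "(u, \<one>\<^bsub>H\<^esub>) \<otimes>\<^bsub>G \<times>\<times> H\<^esub> (\<one>\<^bsub>G\<^esub>, v) = (u, v)" by simp
  with generate.eng[OF u v] show ?thesis by (simp only:)
qed

text \<open>The projections are homomorphisms; conversely, coprime orders make the product of two
  cyclic subgroups cyclic.\<close>

lemma joint_cyclic_DirProd:
  assumes "group G" "group H" "finite (carrier G)" "finite (carrier H)"
    and "coprime (order G) (order H)"
  shows "joint_cyclic (G \<times>\<times> H) (a, b) (a', b') \<longleftrightarrow> joint_cyclic G a a' \<and> joint_cyclic H b b'"
proof
  have P: "group (G \<times>\<times> H)" using DirProd_group assms by blast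
  assume L: "joint_cyclic (G \<times>\<times> H) (a, b) (a', b')"
  interpret f: group_hom "G \<times>\<times> H" G fst
    by (intro group_hom.intro group_hom_axioms.intro homI P assms(1)) (auto simp: mult_DirProd')
  interpret s: group_hom "G \<times>\<times> H" H snd
    by (intro group_hom.intro group_hom_axioms.intro homI P assms(2)) (auto simp: mult_DirProd')
  have "joint_cyclic G a a'" using f.joint_cyclic_image[OF L] by (simp only: fst_conv)
  moreover have "joint_cyclic H b b'" using s.joint_cyclic_image[OF L] by (simp only: snd_conv)
  ultimately show "joint_cyclic G a a' \<and> joint_cyclic H b b'" by blast
next
  assume "joint_cyclic G a a' \<and> joint_cyclic H b b'"
  then obtain w1 w2 where w: "w1 \<in> carrier G" "w2 \<in> carrier H"
    and "a \<in> generate G {w1}" "a' \<in> generate G {w1}" "b \<in> generate H {w2}" "b' \<in> generate H {w2}"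
    unfolding joint_cyclic_def by blast
  then have "(a, b) \<in> generate (G \<times>\<times> H) {(w1, w2)}" "(a', b') \<in> generate (G \<times>\<times> H) {(w1, w2)}"
    using DirProd_in_generate[OF assms w] by blast+
  moreover have "(w1, w2) \<in> carrier (G \<times>\<times> H)" using w by simp
  ultimately show "joint_cyclic (G \<times>\<times> H) (a, b) (a', b')" unfolding joint_cyclic_def by blast
qed

section \<open>Groups whose proper enhanced power graph is a union of cliques\<close>

text \<open>The elements \<open>u\<close> with \<open>\<rho> u = None\<close> are the dominating vertices, and the fibres over \<open>R\<close>
  are the cliques left after deleting them.\<close>

locale ray_group = group K for K (structure) +
  fixes \<rho> :: "'a \<Rightarrow> 'r option" and R :: "'r set"
  assumes finite_carrier: "finite (carrier K)"
    and joint_cyclic_iff: "\<And>u v. u \<in> carrier K \<Longrightarrow> v \<in> carrier K \<Longrightarrow>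
      joint_cyclic K u v \<longleftrightarrow> \<rho> u = None \<or> \<rho> v = None \<or> \<rho> u = \<rho> v"
    and card_rays: "card R \<ge> 2"
    and ray_in: "\<And>u r. u \<in> carrier K \<Longrightarrow> \<rho> u = Some r \<Longrightarrow> r \<in> R"
    and card_fiber: "\<And>r. r \<in> R \<Longrightarrow> card {u \<in> carrier K. \<rho> u = Some r} \<ge> 2"
begin

lemma finite_rays: "finite R"
  using card_rays card.infinite by fastforce

lemma exists_on_ray:
  assumes "r \<in> R"
  obtains u where "u \<in> carrier K" "\<rho> u = Some r"
proof -
  have "{u \<in> carrier K. \<rho> u = Some r} \<noteq> {}" using card_fiber[OF assms] by (metis card.empty not_numeral_le_zero)
  then show thesis using that by blast
qed

lemma other_ray: obtains s where "s \<in> R" "s \<noteq> r"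
proof -
  have "\<not> R \<subseteq> {r}" using card_rays card_mono[of "{r}" R] by auto
  then show thesis using that by blast
qed

lemma exists_not_joint_cyclic:
  assumes "u \<in> carrier K" "\<rho> u = Some r"
  obtains v where "v \<in> carrier K" "\<not> joint_cyclic K u v"
proof -
  obtain s where "s \<in> R" "s \<noteq> r" using other_ray .
  then obtain v where "v \<in> carrier K" "\<rho> v = Some s" using exists_on_ray by blast
  then show thesis using that joint_cyclic_iff[of u v] assms \<open>s \<noteq> r\<close> by auto
qed

text \<open>The factor \<open>Z\<close> imposes no condition, so rays are read off the second
  component, and fibres do not shrink.\<close>

lemma DirProd_cyclic:
  assumes "group Z" "finite (carrier Z)" "coprime (order Z) (order K)"
    and Z: "\<And>u v. u \<in> carrier Z \<Longrightarrow> v \<in> carrier Z \<Longrightarrow> joint_cyclic Z u v"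
  shows "ray_group (Z \<times>\<times> K) (\<lambda>u. \<rho> (snd u)) R"
proof -
  interpret Z: group Z by fact
  interpret P: group "Z \<times>\<times> K" using DirProd_group assms(1) group_axioms by blast
  show ?thesis
  proof (unfold_locales)
    show "finite (carrier (Z \<times>\<times> K))" using finite_carrier assms(2) by simp
    show "card R \<ge> 2" by (rule card_rays)
    show "joint_cyclic (Z \<times>\<times> K) u v \<longleftrightarrow> \<rho> (snd u) = None \<or> \<rho> (snd v) = None \<or> \<rho> (snd u) = \<rho> (snd v)"
      if "u \<in> carrier (Z \<times>\<times> K)" "v \<in> carrier (Z \<times>\<times> K)" for u v
      using joint_cyclic_DirProd[OF assms(1) group_axioms assms(2) finite_carrier assms(3), of "fst u" "snd u" "fst v" "snd v"]
        joint_cyclic_iff[of "snd u" "snd v"] that Z[of "fst u" "fst v"] by auto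
    show "r \<in> R" if "u \<in> carrier (Z \<times>\<times> K)" "\<rho> (snd u) = Some r" for u r
      using that ray_in by auto
    show "2 \<le> card {u \<in> carrier (Z \<times>\<times> K). \<rho> (snd u) = Some r}" if "r \<in> R" for r
    proof -
      have "card {u \<in> carrier K. \<rho> u = Some r} = card (Pair \<one>\<^bsub>Z\<^esub> ` {u \<in> carrier K. \<rho> u = Some r})"
        by (simp add: card_image inj_on_def)
      also have "\<dots> \<le> card {u \<in> carrier (Z \<times>\<times> K). \<rho> (snd u) = Some r}"
        using finite_carrier assms(2) by (intro card_mono) auto
      finally show ?thesis using card_fiber[OF that] by linarith
    qed
  qed
qed

lemma verts_proper: "verts (proper_enhanced_power_graph K) = {u \<in> carrier K. \<rho> u \<noteq> None}"
proof -
  have "(\<exists>v\<in>carrier K. \<not> joint_cyclic K u v) \<longleftrightarrow> \<rho> u \<noteq> None" if u: "u \<in> carrier K" for u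
  proof (cases "\<rho> u")
    case None
    then show ?thesis using joint_cyclic_iff u by simp
  next
    case (Some r)
    then show ?thesis using exists_not_joint_cyclic[OF u Some] by blast
  qed
  then show ?thesis unfolding verts_proper_enhanced_power_graph by blast
qed

lemma adjacent_proper:
  "adjacent (proper_enhanced_power_graph K) u v \<longleftrightarrow>
    u \<in> carrier K \<and> v \<in> carrier K \<and> u \<noteq> v \<and> \<rho> u \<noteq> None \<and> \<rho> u = \<rho> v"
  unfolding adjacent_proper_enhanced_power_graph verts_proper using joint_cyclic_iff[of u v] by (cases "\<rho> u"; cases "\<rho> v") auto

text \<open>A vertex on a ray has a neighbour \<open>v\<close> of the dominating set on that ray,
  and \<open>v\<close> needs a further one there; so two elements per ray are necessary, and any two
  per ray suffice.\<close>

lemma strong_domination_number_rays: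
  "strong_domination_number (proper_enhanced_power_graph K) = 2 * card R"
proof -
  let ?\<Gamma> = "proper_enhanced_power_graph K"
  let ?F = "\<lambda>r. {u \<in> carrier K. \<rho> u = Some r}"
  have "\<exists>A \<subseteq> ?F r. card A = 2" if "r \<in> R" for r
    by (rule obtain_subset_with_card_n[OF card_fiber[OF that]]) blast
  then obtain A where A: "\<And>r. r \<in> R \<Longrightarrow> A r \<subseteq> ?F r" "\<And>r. r \<in> R \<Longrightarrow> card (A r) = 2" by metis
  let ?D = "\<Union>r\<in>R. A r"
  have other: "\<exists>v\<in>S. v \<noteq> u" if "card S = 2" for S :: "'a set" and u
  proof -
    have "\<not> S \<subseteq> {u}" using card_mono[of "{u}" S] that by auto
    then show ?thesis by blast
  qed
  show ?thesis
  proof (rule strong_domination_number_eqI)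
    show "total_dominating_set ?\<Gamma> ?D"
      unfolding total_dominating_set_def
    proof (intro conjI ballI)
      show "?D \<subseteq> verts ?\<Gamma>" using A(1) verts_proper by fastforce
      fix u assume "u \<in> verts ?\<Gamma>"
      then obtain r where u: "u \<in> carrier K" "\<rho> u = Some r" using verts_proper by auto
      then have r: "r \<in> R" using ray_in by blast
      obtain v where "v \<in> A r" "v \<noteq> u" using other[OF A(2)[OF r]] by blast
      moreover have "v \<in> carrier K" "\<rho> v = Some r" using \<open>v \<in> A r\<close> A(1)[OF r] by blast+
      ultimately have "adjacent ?\<Gamma> u v" using u unfolding adjacent_proper by simp
      then show "\<exists>v\<in>?D. adjacent ?\<Gamma> u v" using r \<open>v \<in> A r\<close> by blast
    qed
    have finA: "finite (A r)" if "r \<in> R" for r using A(2)[OF that] card_ge_0_finite[of "A r"] by simp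
    then show "finite ?D" using finite_rays by blast
    have "card ?D \<le> (\<Sum>r\<in>R. card (A r))" using finite_rays by (rule card_UN_le)
    also have "\<dots> = 2 * card R" using A(2) by simp
    finally show "card ?D \<le> 2 * card R" .
  next
    fix D assume D: "total_dominating_set ?\<Gamma> D" "finite D"
    then have DV: "D \<subseteq> verts ?\<Gamma>" unfolding total_dominating_set_def by blast
    have dom: "\<exists>v\<in>D. adjacent ?\<Gamma> u v" if "u \<in> verts ?\<Gamma>" for u
      using that D(1) unfolding total_dominating_set_def by blast
    have two: "card (D \<inter> ?F r) \<ge> 2" if r: "r \<in> R" for r
    proof -
      obtain u where u: "u \<in> carrier K" "\<rho> u = Some r" using exists_on_ray[OF r] .
      then have "u \<in> verts ?\<Gamma>" using verts_proper by simp
      then obtain v where v: "v \<in> D" "adjacent ?\<Gamma> u v" using dom by blast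
      then obtain w where w: "w \<in> D" "adjacent ?\<Gamma> v w" using dom DV by blast
      have "v \<in> ?F r" using u v(2) unfolding adjacent_proper by simp
      moreover have "w \<in> ?F r" "v \<noteq> w" using calculation w(2) unfolding adjacent_proper by simp_all
      ultimately have "{v, w} \<subseteq> D \<inter> ?F r" "v \<noteq> w" using v(1) w(1) by blast+
      moreover have "finite (D \<inter> ?F r)" using D(2) by simp
      ultimately show ?thesis using card_mono[of "D \<inter> ?F r" "{v, w}"] by simp
    qed
    have "2 * card R = (\<Sum>r\<in>R. 2)" by simp
    also have "\<dots> \<le> (\<Sum>r\<in>R. card (D \<inter> ?F r))" using two by (rule sum_mono)
    also have "\<dots> = card (\<Union>r\<in>R. D \<inter> ?F r)"
      using finite_rays D(2) by (intro card_UN_disjoint[symmetric]) auto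
    also have "\<dots> \<le> card D" using D(2) by (intro card_mono) auto
    finally show "2 * card R \<le> card D" .
  qed
qed

end

section \<open>Cyclic groups and generalized quaternion groups\<close>

lemma joint_cyclic_integer_mod_group:
  assumes "n > 0" "u \<in> carrier (integer_mod_group n)" "v \<in> carrier (integer_mod_group n)"
  shows "joint_cyclic (integer_mod_group n) u v"
proof -
  let ?Z = "integer_mod_group n"
  interpret group ?Z by simp
  \<comment> \<open>The residue of 1 is taken so that \<open>n = 1\<close> is covered, where it is
    0.\<close>
  have w: "1 mod int n \<in> carrier ?Z" using assms(1) by (simp add: carrier_integer_mod_group)
  have "t \<in> generate ?Z {1 mod int n}" if "t \<in> carrier ?Z" for t
  proof -
    have "(1 mod int n) [^]\<^bsub>?Z\<^esub> t = (t * (1 mod int n)) mod int n" by (rule int_pow_integer_mod_group)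
    also have "\<dots> = t mod int n" by (metis mod_mult_right_eq mult.right_neutral)
    also have "\<dots> = t" using that assms(1) by (simp add: carrier_integer_mod_group)
    finally show ?thesis using int_pow_in_generate[OF w, of t] by simp
  qed
  then show ?thesis using assms(2,3) w unfolding joint_cyclic_def by blast
qed

text \<open>\<open>generate Q {x}\<close> has index 2, and \<open>z\<close> is its involution.
  Conjugation by \<open>y\<close> inverts this subgroup, so \<open>c \<otimes> y\<close> squares to
  \<open>y \<otimes> y = z\<close>. The prescribed order of \<open>Q\<close> forces \<open>x\<close>
  to have the full order \<open>2 ^ (k - 1)\<close>.\<close>

lemma generalized_quaternion_structure:
  fixes Q (structure)
  assumes Q: "generalized_quaternion k Q" and k: "k \<ge> 3"
  obtains x z where "x \<in> carrier Q" "card (generate Q {x}) = 2 ^ (k - 1)" "z \<in> generate Q {x}"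
    "z \<noteq> \<one>" "z \<otimes> z = \<one>" "\<And>q. q \<in> carrier Q - generate Q {x} \<Longrightarrow> q \<otimes> q = z"
proof -
  interpret group Q using Q unfolding generalized_quaternion_def by blast
  have ordQ: "order Q = 2 ^ k" using Q unfolding generalized_quaternion_def by blast
  then have fin: "finite (carrier Q)" using order_gt_0_iff_finite by simp
  obtain x y where x: "x \<in> carrier Q" and y: "y \<in> carrier Q" and gen: "generate Q {x, y} = carrier Q"
    and x1: "x [^] ((2::nat) ^ (k - 1)) = \<one>" and xy: "x [^] ((2::nat) ^ (k - 2)) = y [^] (2::nat)"
    and conj: "y \<otimes> x \<otimes> inv y = inv x"
    using Q unfolding generalized_quaternion_def by blast
  define z where "z = x [^] ((2::nat) ^ (k - 2))"
  define C where "C = generate Q {x}"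
  have C: "subgroup C Q" unfolding C_def using generate_is_subgroup x by simp
  have C_eq: "C = range (\<lambda>i::nat. x [^] i)" unfolding C_def using generate_eq_nat_pow fin x by blast
  have Cc: "c \<in> carrier Q" if "c \<in> C" for c using subgroup.mem_carrier[OF C that] .
  have zC: "z \<in> C" unfolding z_def C_eq by blast
  have zc: "z \<in> carrier Q" using zC Cc by blast
  have yy: "y \<otimes> y = z" unfolding z_def xy using y by (simp add: numeral_2_eq_2)
  \<comment> \<open>\<open>inv x\<close> is written as a natural power with exponent
    \<open>ord x - 1\<close>, the form in which \<open>conj_nat_pow\<close> takes the
    relation.\<close>
  have "ord x > 0" using ord_ge_1[OF fin x] by simp
  then obtain s where s: "ord x = Suc s" using gr0_conv_Suc by blast
  have "x [^] s \<otimes> x = \<one>" using pow_ord_eq_1[OF x] unfolding s by simp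
  then have "inv x = x [^] s" using inv_equality x by simp
  then have "y \<otimes> x \<otimes> inv y = x [^] s" using conj by simp
  then have yx: "y \<otimes> x = x [^] s \<otimes> y" using x y by (metis inv_solve_right m_closed nat_pow_closed)
  have yc: "y \<otimes> c = inv c \<otimes> y" if c: "c \<in> C" for c
  proof -
    obtain i where i: "c = x [^] (i::nat)" using c C_eq by blast
    have "x [^] (i * s) \<otimes> x [^] i = x [^] (ord x * i)"
      using x by (simp add: nat_pow_mult s algebra_simps)
    also have "\<dots> = \<one>" using x by (simp add: nat_pow_pow[symmetric])
    finally have "inv c = x [^] (i * s)" using inv_equality x i by simp
    then show ?thesis using conj_nat_pow[OF x y yx, of i] i by simp
  qed
  have yc': "y \<otimes> (c \<otimes> g) = inv c \<otimes> (y \<otimes> g)" if "c \<in> C" "g \<in> carrier Q" for c g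
    using yc[OF that(1)] that(2) Cc[OF that(1)] y by (simp add: m_assoc[symmetric])
  let ?S = "C \<union> (\<lambda>c. c \<otimes> y) ` C"
  have "\<one> \<in> C" using subgroup.one_closed[OF C] .
  have xC: "x \<in> C" unfolding C_def by (simp add: generate.incl)
  note closed = subgroup.m_closed[OF C] subgroup.m_inv_closed[OF C]
  \<comment> \<open>\<open>?S\<close> contains the generators and their inverses, as
    \<open>inv y = inv z \<otimes> y\<close>, and it is closed under products, as \<open>y\<close>
    passes elements of \<open>C\<close> by inverting them.\<close>
  have "g \<in> ?S" if "g \<in> generate Q {x, y}" for g
    using that
  proof (induction rule: generate.induct)
    case one
    then show ?case using \<open>\<one> \<in> C\<close> by blast
  next
    case (incl h)
    have "y = \<one> \<otimes> y" using y by simp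
    then have "y \<in> ?S" using \<open>\<one> \<in> C\<close> by blast
    then show ?case using incl xC by blast
  next
    case (inv h)
    have "inv z \<otimes> y \<otimes> y = \<one>" using y zc yy by (simp add: m_assoc)
    then have "inv y = inv z \<otimes> y" using inv_equality y zc by simp
    then have "inv y \<in> ?S" using closed(2)[OF zC] by blast
    then show ?case using inv xC closed(2) by blast
  next
    case (eng g h)
    obtain c where c: "c \<in> C" "g = c \<or> g = c \<otimes> y" using eng.IH(1) by blast
    obtain d where d: "d \<in> C" "h = d \<or> h = d \<otimes> y" using eng.IH(2) by blast
    have 1: "c \<otimes> (d \<otimes> y) = (c \<otimes> d) \<otimes> y" using Cc c d y by (simp add: m_assoc)
    have 2: "c \<otimes> y \<otimes> d = (c \<otimes> inv d) \<otimes> y" using Cc c d y yc[OF d(1)] by (simp add: m_assoc)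
    have 3: "c \<otimes> y \<otimes> (d \<otimes> y) = c \<otimes> inv d \<otimes> z"
      using Cc c d y zc yc'[OF d(1) y] yy by (simp add: m_assoc)
    have "c \<otimes> d \<in> C" "c \<otimes> inv d \<in> C" "c \<otimes> inv d \<otimes> z \<in> C" using closed c(1) d(1) zC by simp_all
    then show ?case using c(2) d(2) 1 2 3 by (elim disjE) auto
  qed
  then have S: "carrier Q \<subseteq> ?S" using gen by blast
  have finC: "finite C" using C fin subgroup.subset finite_subset by metis
  \<comment> \<open>Two sets of at most \<open>card C\<close> elements cover a group of order
    \<open>2 ^ k\<close>, while \<open>card C\<close> divides \<open>2 ^ (k - 1)\<close>.\<close>
  have "2 ^ k \<le> card ?S" using S ordQ finC unfolding order_def by (metis card_mono finite_UnI finite_imageI)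
  also have "\<dots> \<le> card C + card C"
    using card_Un_le[of C "(\<lambda>c. c \<otimes> y) ` C"] card_image_le[OF finC, of "\<lambda>c. c \<otimes> y"] by linarith
  finally have ge: "2 ^ k \<le> 2 * card C" by simp
  have k': "k = Suc (k - 1)" "k - 1 = Suc (k - 2)" using k by simp_all
  have ordC: "ord x = card C" unfolding C_def using generate_pow_card[OF x] .
  have "card C dvd 2 ^ (k - 1)" using x1 pow_eq_id[OF x] ordC by simp
  then have "card C \<le> 2 ^ (k - 1)" by (simp add: dvd_imp_le)
  moreover have "2 * 2 ^ (k - 1) = (2::nat) ^ k" by (subst (2) k'(1)) simp
  ultimately have cardC: "card C = 2 ^ (k - 1)" using ge by linarith
  have half: "(2::nat) ^ (k - 1) = 2 ^ (k - 2) + 2 ^ (k - 2)" unfolding k'(2) by simp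
  have "z \<noteq> \<one>"
  proof
    assume "z = \<one>"
    then have "2 ^ (k - 1) dvd (2::nat) ^ (k - 2)" unfolding z_def using pow_eq_id[OF x] ordC cardC by simp
    then have "(2::nat) ^ (k - 1) \<le> 2 ^ (k - 2)" by (simp add: dvd_imp_le)
    then show False using half by simp
  qed
  moreover have "z \<otimes> z = \<one>" unfolding z_def using x x1 half by (simp add: nat_pow_mult)
  moreover have "q \<otimes> q = z" if q: "q \<in> carrier Q - C" for q
  proof -
    obtain c where c: "c \<in> C" "q = c \<otimes> y" using q S by blast
    have "q \<otimes> q = c \<otimes> (y \<otimes> (c \<otimes> y))" unfolding c(2) using Cc[OF c(1)] y by (simp add: m_assoc)
    also have "\<dots> = c \<otimes> (inv c \<otimes> (y \<otimes> y))" using yc'[OF c(1) y] by simp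
    also have "\<dots> = z" using Cc[OF c(1)] yy zc by (simp add: m_assoc[symmetric])
    finally show ?thesis .
  qed
  ultimately show thesis using that[of x z] x zC cardC unfolding C_def by blast
qed

text \<open>The maximal cyclic subgroups are \<open>C\<close> and, for \<open>q\<close> outside
  \<open>C\<close>, the sets \<open>{\<one>, z, q, z \<otimes> q}\<close>; distinct ones meet in
  \<open>{\<one>, z}\<close>. As ray labels serve \<open>C\<close> itself and the pairs
  \<open>{q, z \<otimes> q}\<close>.\<close>

lemma generalized_quaternion_ray_group:
  fixes Q :: "('q, 'm) monoid_scheme" (structure)
  assumes Q: "generalized_quaternion k Q" and k: "k \<ge> 3"
  obtains \<rho> :: "'q \<Rightarrow> 'q set option" and R where "ray_group Q \<rho> R" "card R = 2 ^ (k - 2) + 1"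
proof -
  interpret group Q using Q unfolding generalized_quaternion_def by blast
  have ordQ: "order Q = 2 ^ k" using Q unfolding generalized_quaternion_def by blast
  then have fin: "finite (carrier Q)" using order_gt_0_iff_finite by simp
  obtain x z where x: "x \<in> carrier Q" and cardC: "card (generate Q {x}) = 2 ^ (k - 1)"
    and zC: "z \<in> generate Q {x}" and z1: "z \<noteq> \<one>" and zz: "z \<otimes> z = \<one>"
    and sq: "\<And>q. q \<in> carrier Q - generate Q {x} \<Longrightarrow> q \<otimes> q = z"
    using generalized_quaternion_structure[OF Q k] by blast
  define C where "C = generate Q {x}"
  note cardC = cardC[folded C_def] and zC = zC[folded C_def] and sq = sq[folded C_def]
  have C: "subgroup C Q" unfolding C_def using generate_is_subgroup x by simp
  have Cc: "C \<subseteq> carrier Q" using C subgroup.subset by blast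
  have finC: "finite C" using Cc fin finite_subset by blast
  have zc: "z \<in> carrier Q" using zC Cc by blast
  have oneC: "\<one> \<in> C" using subgroup.one_closed[OF C] .
  have z_out: "z \<otimes> q \<in> carrier Q - C" "z \<otimes> q \<noteq> q" "z \<otimes> (z \<otimes> q) = q" if "q \<in> carrier Q - C" for q
  proof -
    show zzq: "z \<otimes> (z \<otimes> q) = q" using that zc zz by (simp add: m_assoc[symmetric])
    have "z \<otimes> q \<notin> C" using subgroup.m_closed[OF C zC, of "z \<otimes> q"] zzq that by auto
    then show "z \<otimes> q \<in> carrier Q - C" using zc that by simp
    show "z \<otimes> q \<noteq> q" using that zc z1 by simp
  qed
  \<comment> \<open>Since \<open>w \<otimes> w = z\<close>, the powers of \<open>w\<close> run
    through four elements.\<close>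
  have gen_out: "generate Q {w} \<subseteq> {\<one>, z, w, z \<otimes> w}" if w: "w \<in> carrier Q - C" for w
  proof -
    have "w [^] (n::nat) \<in> {\<one>, z, w, z \<otimes> w}" for n
    proof (induction n)
      case (Suc n)
      have "z \<otimes> w \<otimes> w = \<one>" using w zc sq[OF w] zz by (simp add: m_assoc)
      then show ?case using Suc sq[OF w] w by auto
    qed simp
    then show ?thesis using generate_eq_nat_pow[OF fin, of w] w by auto
  qed
  have z_gen: "z \<in> generate Q {w}" "z \<otimes> w \<in> generate Q {w}" if w: "w \<in> carrier Q - C" for w
  proof -
    have "w \<in> generate Q {w}" by (simp add: generate.incl)
    then show "z \<in> generate Q {w}" using generate.eng[of w Q "{w}" w] sq[OF w] by simp
    then show "z \<otimes> w \<in> generate Q {w}" using generate.eng[of z Q "{w}" w] generate.incl[of w "{w}" Q] by simp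
  qed
  define ray where "ray q = (if q \<in> C then C else {q, z \<otimes> q})" for q
  define \<rho> where "\<rho> q = (if q \<in> {\<one>, z} then None else Some (ray q))" for q
  define T where "T = (\<lambda>q. {q, z \<otimes> q}) ` (carrier Q - C)"
  have CT: "C \<notin> T" unfolding T_def by auto
  have pair_eq: "{q, z \<otimes> q} = {q', z \<otimes> q'}"
    if "q \<in> carrier Q - C" "q' \<in> carrier Q - C" "{q, z \<otimes> q} \<inter> {q', z \<otimes> q'} \<noteq> {}" for q q'
  proof -
    have "q = q' \<or> q = z \<otimes> q' \<or> z \<otimes> q = q' \<or> z \<otimes> q = z \<otimes> q'" using that(3) by blast
    moreover have "q = q'" if "z \<otimes> q = z \<otimes> q'"
      using that z_out(3)[OF \<open>q \<in> carrier Q - C\<close>] z_out(3)[OF \<open>q' \<in> carrier Q - C\<close>] by metis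
    ultimately have "q = q' \<or> q = z \<otimes> q' \<and> z \<otimes> q = q'" using z_out(3)[OF that(1)] z_out(3)[OF that(2)] by metis
    then show ?thesis by auto
  qed
  have "\<Union>T = carrier Q - C" unfolding T_def using z_out(1) by auto
  moreover have "finite T" unfolding T_def using fin by simp
  \<comment> \<open>The \<open>2 ^ (k - 1)\<close> elements outside \<open>C\<close> fall into
    disjoint pairs, which gives \<open>2 ^ (k - 2)\<close> rays besides \<open>C\<close>.\<close>
  moreover have "2 * card T = card (\<Union>T)"
  proof (rule card_partition)
    show "finite T" "finite (\<Union>T)" using \<open>\<Union>T = carrier Q - C\<close> fin \<open>finite T\<close> by simp_all
    show "card c = 2" if c: "c \<in> T" for c
    proof -
      obtain q where "q \<in> carrier Q - C" "c = {q, z \<otimes> q}" using c unfolding T_def by blast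
      then show ?thesis using not_sym[OF z_out(2)[of q]] by simp
    qed
    show "c1 \<inter> c2 = {}" if c: "c1 \<in> T" "c2 \<in> T" "c1 \<noteq> c2" for c1 c2
    proof -
      obtain q q' where "q \<in> carrier Q - C" "q' \<in> carrier Q - C" "c1 = {q, z \<otimes> q}" "c2 = {q', z \<otimes> q'}"
        using c(1,2) unfolding T_def by blast
      then show ?thesis using pair_eq[of q q'] c(3) by metis
    qed
  qed
  moreover have "card (carrier Q - C) = 2 ^ k - 2 ^ (k - 1)"
    using card_Diff_subset[OF finC Cc] cardC ordQ unfolding order_def by simp
  moreover have "k = Suc (Suc (k - 2))" using k by simp
  then obtain j where "k = Suc (Suc j)" by blast
  then have "(2::nat) ^ k = 4 * 2 ^ (k - 2)" "(2::nat) ^ (k - 1) = 2 * 2 ^ (k - 2)" by simp_all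
  ultimately have cardT: "card T = 2 ^ (k - 2)" by simp
  have cardR: "card (insert C T) = 2 ^ (k - 2) + 1" using CT \<open>finite T\<close> cardT by simp
  have "ray_group Q \<rho> (insert C T)"
  proof unfold_locales
    show "finite (carrier Q)" by fact
    show "2 \<le> card (insert C T)" using cardR by simp
    show "r \<in> insert C T" if "u \<in> carrier Q" "\<rho> u = Some r" for u r
      using that unfolding \<rho>_def ray_def T_def by (auto split: if_splits)
    show "2 \<le> card {u \<in> carrier Q. \<rho> u = Some r}" if r: "r \<in> insert C T" for r
    proof (cases "r = C")
      case True
      \<comment> \<open>\<open>k \<ge> 3\<close> gives \<open>C\<close> at least four elements, so
        two remain besides \<open>\<one>\<close> and \<open>z\<close>.\<close>
      have "2 ^ 2 \<le> (2::nat) ^ (k - 1)" using k by (intro power_increasing) simp_all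
      then have "2 \<le> card (C - {\<one>, z})" using cardC zC oneC z1 card_Diff_subset[of "{\<one>, z}" C] by simp
      also have "C - {\<one>, z} \<subseteq> {u \<in> carrier Q. \<rho> u = Some r}" using Cc True unfolding \<rho>_def ray_def by auto
      then have "card (C - {\<one>, z}) \<le> card {u \<in> carrier Q. \<rho> u = Some r}" using fin by (intro card_mono) auto
      finally show ?thesis .
    next
      case False
      then obtain q where q: "q \<in> carrier Q - C" "r = {q, z \<otimes> q}" using r unfolding T_def by blast
      have "z \<otimes> q \<notin> C" "z \<otimes> q \<in> carrier Q" "z \<otimes> q \<noteq> q" "z \<otimes> (z \<otimes> q) = q" using z_out[OF q(1)] by auto
      then have "{q, z \<otimes> q} \<subseteq> {u \<in> carrier Q. \<rho> u = Some r}"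
        using q zC oneC unfolding \<rho>_def ray_def by auto
      then have "card {q, z \<otimes> q} \<le> card {u \<in> carrier Q. \<rho> u = Some r}" using fin by (intro card_mono) auto
      then show ?thesis using z_out(2)[OF q(1)] by simp
    qed
    show "joint_cyclic Q u v \<longleftrightarrow> \<rho> u = None \<or> \<rho> v = None \<or> \<rho> u = \<rho> v"
      if uv: "u \<in> carrier Q" "v \<in> carrier Q" for u v
    proof
      assume "joint_cyclic Q u v"
      then obtain w where w: "w \<in> carrier Q" "u \<in> generate Q {w}" "v \<in> generate Q {w}"
        unfolding joint_cyclic_def by blast
      show "\<rho> u = None \<or> \<rho> v = None \<or> \<rho> u = \<rho> v"
      proof (cases "w \<in> C")
        case True
        then have "generate Q {w} \<subseteq> C" using generate_subgroup_incl[of "{w}" C] C by simp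
        then show ?thesis using w unfolding \<rho>_def ray_def by auto
      next
        case False
        then have w': "w \<in> carrier Q - C" using w(1) by simp
        have "\<rho> t = None \<or> \<rho> t = Some {w, z \<otimes> w}" if "t \<in> generate Q {w}" for t
          using that gen_out[OF w'] z_out[OF w'] w' unfolding \<rho>_def ray_def by auto
        then show ?thesis using w(2,3) by metis
      qed
    next
      have C_jc: "joint_cyclic Q u v" if "u \<in> C" "v \<in> C" for u v
        using that x unfolding joint_cyclic_def C_def by blast
      have None_jc: "joint_cyclic Q u v" if "\<rho> u = None" "v \<in> carrier Q" for u v
      proof -
        have "u = \<one> \<or> u = z" using that(1) unfolding \<rho>_def by (auto split: if_splits)
        then show ?thesis
          using joint_cyclic_one[OF that(2)] C_jc[OF zC] joint_cyclic_if_mem_generate[OF that(2)] z_gen(1) that(2)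
          by blast
      qed
      assume "\<rho> u = None \<or> \<rho> v = None \<or> \<rho> u = \<rho> v"
      then consider "\<rho> u = None" | "\<rho> v = None" | "ray u = ray v"
        unfolding \<rho>_def by (auto split: if_splits)
      then show "joint_cyclic Q u v"
      proof cases
        case 1
        then show ?thesis using None_jc uv by blast
      next
        case 2
        then show ?thesis using None_jc[OF 2 uv(1)] joint_cyclic_sym by metis
      next
        case 3
        show ?thesis
        proof (cases "u \<in> C")
          case True
          then have "v \<in> C" using 3 unfolding ray_def by (auto split: if_splits)
          then show ?thesis using C_jc True by blast
        next
          case False
          have "v \<notin> C" using 3 False unfolding ray_def by (auto split: if_splits)
          then have "v = u \<or> v = z \<otimes> u" using 3 False unfolding ray_def by auto
          then have "v \<in> generate Q {u}" using z_gen(2)[of u] False uv(1) generate.incl[of u "{u}" Q] by auto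
          then show ?thesis using joint_cyclic_if_mem_generate[OF uv(1)] joint_cyclic_sym by metis
        qed
      qed
    qed
  qed
  then show thesis using that cardR by blast
qed

section \<open>Subgroups of prime order as rays\<close>

text \<open>For prime \<open>q\<close> and \<open>u\<close> of finite order this is the unique
  subgroup of order \<open>q\<close> in the cyclic group generated by \<open>u\<close>, and
  \<open>None\<close> if there is no such subgroup.\<close>

definition prime_ray :: "('a, 'b) monoid_scheme \<Rightarrow> nat \<Rightarrow> 'a \<Rightarrow> 'a set option"
  where "prime_ray G q u =
    (if q dvd group.ord G u then Some (generate G {u [^]\<^bsub>G\<^esub> (group.ord G u div q)}) else None)"

context group
begin

lemma ord_ne_0: "finite (carrier G) \<Longrightarrow> u \<in> carrier G \<Longrightarrow> ord u \<noteq> 0"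
  using ord_ge_1[of u] by simp

lemma prime_ray_eqI:
  assumes "finite (carrier G)" "u \<in> carrier G" "subgroup H G" "card H = q" "prime q" "H \<subseteq> generate G {u}"
  shows "prime_ray G q u = Some H"
  using prime_card_subgroup_in_cyclic[OF assms(2) ord_ne_0[OF assms(1,2)] assms(3-6)]
  unfolding prime_ray_def by simp

lemma prime_ray_SomeD:
  assumes "finite (carrier G)" "u \<in> carrier G" "prime q" "prime_ray G q u = Some H"
  shows "subgroup H G" "card H = q" "H \<subseteq> generate G {u}"
  using cyclic_prime_card_subgroup[OF assms(2) ord_ne_0[OF assms(1,2)] assms(3)] assms(4)
  unfolding prime_ray_def by (auto split: if_splits)

text \<open>Both subgroups lie in the cyclic group that contains \<open>u\<close> and
  \<open>v\<close>, where a subgroup of order \<open>q\<close> is unique.\<close>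

lemma prime_ray_joint_cyclic:
  assumes "finite (carrier G)" "prime q" "joint_cyclic G u v"
    and "prime_ray G q u = Some H" "prime_ray G q v = Some K"
  shows "H = K"
proof -
  obtain w where w: "w \<in> carrier G" "u \<in> generate G {w}" "v \<in> generate G {w}"
    using assms(3) unfolding joint_cyclic_def by blast
  have uv: "u \<in> carrier G" "v \<in> carrier G" using w generate_singleton_carrier by blast+
  note H = prime_ray_SomeD[OF assms(1) uv(1) assms(2,4)]
    and K = prime_ray_SomeD[OF assms(1) uv(2) assms(2,5)]
  have "H \<subseteq> generate G {w}" "K \<subseteq> generate G {w}"
    using H(3) K(3) generate_singleton_mono w by blast+
  then have "prime_ray G q w = Some H" "prime_ray G q w = Some K"
    using prime_ray_eqI assms(1,2) w(1) H K by blast+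
  then show ?thesis by simp
qed

lemma exists_prime_ray:
  assumes "finite (carrier G)" "u \<in> carrier G" "u \<noteq> \<one>"
  obtains q where "q \<in> prime_factors (order G)" "prime_ray G q u \<noteq> None"
proof -
  have "ord u \<noteq> 1" using assms(2,3) ord_eq_1 by blast
  then obtain q where "prime q" "q dvd ord u" using prime_factor_nat by blast
  moreover have "ord u dvd order G" using assms(2) by (rule ord_dvd_group_order)
  moreover have "order G \<noteq> 0" using assms(1) order_gt_0_iff_finite by simp
  ultimately have "q \<in> prime_factors (order G)" by (meson dvd_trans in_prime_factors_iff)
  then show thesis using that \<open>q dvd ord u\<close> unfolding prime_ray_def by simp
qed

text \<open>Subgroups for different primes have generators of coprime orders; these commute, so each
  of them is a power of their product.\<close>

lemma exists_with_prime_rays: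
  assumes fin: "finite (carrier G)"
    and comm: "\<And>a b. a \<in> carrier G \<Longrightarrow> b \<in> carrier G \<Longrightarrow> coprime (ord a) (ord b) \<Longrightarrow> a \<otimes> b = b \<otimes> a"
    and "finite S" "\<And>q. q \<in> S \<Longrightarrow> prime q \<and> subgroup (H q) G \<and> card (H q) = q"
  obtains u where "u \<in> carrier G" "\<And>q. q \<in> S \<Longrightarrow> prime_ray G q u = Some (H q)"
proof -
  \<comment> \<open>The invariant \<open>ord u dvd \<Prod>S\<close> keeps the order of the partial
    product coprime to the next prime.\<close>
  have "\<exists>u\<in>carrier G. ord u dvd \<Prod>S \<and> (\<forall>q\<in>S. H q \<subseteq> generate G {u})"
    using assms(3,4)
  proof (induction S rule: finite_induct)
    case empty
    then show ?case by (intro bexI[of _ \<one>]) auto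
  next
    case (insert q S)
    then obtain u where u: "u \<in> carrier G" "ord u dvd \<Prod>S" "\<And>q'. q' \<in> S \<Longrightarrow> H q' \<subseteq> generate G {u}"
      by auto
    have q: "prime q" "subgroup (H q) G" "card (H q) = q" using insert.prems by simp_all
    obtain h where h: "h \<in> H q" "h \<noteq> \<one>" "h \<in> carrier G"
      using prime_card_subgroup_nontrivial[OF q(2,3,1)] .
    note oh = prime_card_subgroup_generate[OF q(2,3,1) h(1,2)]
    have "coprime q q'" if "q' \<in> S" for q'
    proof (rule primes_coprime)
      show "q \<noteq> q'" using that insert.hyps(2) by blast
    qed (use q(1) insert.prems[of q'] that in simp_all)
    then have "coprime q (\<Prod>S)" by (intro prod_coprime_right) simp
    then have co: "coprime (ord u) (ord h)"
      using u(2) oh(1) by (metis coprime_commute coprime_divisors dvd_refl)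
    have uh: "u \<otimes> h = h \<otimes> u" using comm u(1) h(3) co by blast
    note gen = coprime_commuting_in_generate[OF u(1) h(3) uh pow_ord_eq_1[OF u(1)] pow_ord_eq_1[OF h(3)] co]
    have uhc: "u \<otimes> h \<in> carrier G" using u(1) h(3) by simp
    have "ord (u \<otimes> h) dvd ord u * ord h" using uh u(1) h(3) ord_mul_divides by blast
    also have "\<dots> dvd \<Prod>S * q" using u(2) oh(1) by (simp add: mult_dvd_mono)
    also have "\<Prod>S * q = \<Prod>(insert q S)" using insert.hyps by (simp add: mult.commute)
    finally have "ord (u \<otimes> h) dvd \<Prod>(insert q S)" .
    moreover have "H q \<subseteq> generate G {u \<otimes> h}"
      using generate_singleton_mono[OF uhc gen(2)] oh(2) by simp
    moreover have "H q' \<subseteq> generate G {u \<otimes> h}" if "q' \<in> S" for q'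
      using generate_singleton_mono[OF uhc gen(1)] u(3)[OF that] by blast
    ultimately show ?case using uhc by blast
  qed
  then obtain u where "u \<in> carrier G" "\<And>q. q \<in> S \<Longrightarrow> H q \<subseteq> generate G {u}" by blast
  then have "prime_ray G q u = Some (H q)" if "q \<in> S" for q
    using prime_ray_eqI[OF fin, of u "H q" q] assms(4)[OF that] that by simp
  then show thesis using that \<open>u \<in> carrier G\<close> by blast
qed

end

lemma card_insert_image_le: "finite A \<Longrightarrow> card (insert x (f ` A)) \<le> card A + 1"
  using card_insert_le_m1[of "card A + 1" "f ` A" x] card_image_le[of A f] by simp

section \<open>Product of a ray group with a group of coprime order\<close>

text \<open>The factor \<open>K\<close> adds one index with \<open>card R\<close> rays to the primes
  dividing \<open>order G\<close>. Having two subgroups of order \<open>p\<close> ensures that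
  elements of order \<open>p\<close> are not dominating.\<close>

lemma strong_domination_number_DirProd_rays:
  fixes G :: "('a, 'm) monoid_scheme" and K :: "('k, 'n) monoid_scheme"
    and \<rho> :: "'k \<Rightarrow> 'r option"
  assumes G: "group G" "finite (carrier G)"
    and comm: "\<And>a b. a \<in> carrier G \<Longrightarrow> b \<in> carrier G \<Longrightarrow> coprime (group.ord G a) (group.ord G b) \<Longrightarrow>
      a \<otimes>\<^bsub>G\<^esub> b = b \<otimes>\<^bsub>G\<^esub> a"
    and K: "ray_group K \<rho> R"
    and co: "coprime (order G) (order K)"
    and p: "p \<in> prime_factors (order G)" "card {H. subgroup H G \<and> card H = p} \<ge> 2"
    and minimal: "\<And>q. q \<in> prime_factors (order G) \<Longrightarrow>
      card {H. subgroup H G \<and> card H = p} \<le> card {H. subgroup H G \<and> card H = q}"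
  shows "strong_domination_number (proper_enhanced_power_graph (G \<times>\<times> K)) =
    min (card {H. subgroup H G \<and> card H = p}) (card R) + 1"
proof -
  interpret G: group G by fact
  interpret K: ray_group K \<rho> R by fact
  interpret P: group "G \<times>\<times> K" using DirProd_group G.group_axioms K.group_axioms by blast
  let ?\<Gamma> = "proper_enhanced_power_graph (G \<times>\<times> K)"
  let ?N = "\<lambda>q. {H. subgroup H G \<and> card H = q}"
  let ?c = "min (card (?N p)) (card R)"
  have jc: "joint_cyclic (G \<times>\<times> K) (a, b) (a', b') \<longleftrightarrow> joint_cyclic G a a' \<and> joint_cyclic K b b'" for a b a' b'
    using joint_cyclic_DirProd[OF G(1) K.group_axioms G(2) K.finite_carrier co] .
  have verts: "(a, b) \<in> verts ?\<Gamma> \<longleftrightarrow> a \<in> carrier G \<and> b \<in> carrier K \<and>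
      (\<exists>a'\<in>carrier G. \<exists>b'\<in>carrier K. \<not> (joint_cyclic G a a' \<and> joint_cyclic K b b'))" for a b
    unfolding P.verts_proper_enhanced_power_graph by (auto simp: jc)
  have adj: "adjacent ?\<Gamma> u v \<longleftrightarrow> u \<in> verts ?\<Gamma> \<and> v \<in> verts ?\<Gamma> \<and> u \<noteq> v \<and> joint_cyclic (G \<times>\<times> K) u v" for u v
    by (rule adjacent_proper_enhanced_power_graph)
  have primep: "prime p" using p(1) by auto
  have finN: "finite (?N p)" using p(2) card_ge_0_finite[of "?N p"] by simp
  have vertsK: "(a, b) \<in> verts ?\<Gamma>" if ab: "a \<in> carrier G" "b \<in> carrier K" "\<rho> b = Some r" for a b r
  proof -
    obtain b' where "b' \<in> carrier K" "\<not> joint_cyclic K b b'" using K.exists_not_joint_cyclic[OF ab(2,3)] .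
    then show ?thesis unfolding verts using ab(1,2) by blast
  qed
  define h where "h H = (SOME x. x \<in> H \<and> x \<noteq> \<one>\<^bsub>G\<^esub>)" for H
  have h: "h H \<in> carrier G" "generate G {h H} = H" "prime_ray G p (h H) = Some H" if "H \<in> ?N p" for H
  proof -
    have H: "subgroup H G" "card H = p" using that by simp_all
    then have "\<exists>x. x \<in> H \<and> x \<noteq> \<one>\<^bsub>G\<^esub>" using G.prime_card_subgroup_nontrivial[OF H primep] by metis
    then have hH: "h H \<in> H" "h H \<noteq> \<one>\<^bsub>G\<^esub>" unfolding h_def using someI_ex[of "\<lambda>x. x \<in> H \<and> x \<noteq> \<one>\<^bsub>G\<^esub>"] by blast+
    then show "h H \<in> carrier G" using subgroup.mem_carrier[OF H(1)] by blast
    show *: "generate G {h H} = H" using G.prime_card_subgroup_generate(2)[OF H primep hH] .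
    show "prime_ray G p (h H) = Some H"
      using G.prime_ray_eqI[OF G(2) \<open>h H \<in> carrier G\<close> H primep] * by simp
  qed
  \<comment> \<open>A second subgroup \<open>H'\<close> supplies an element that shares no cyclic
    subgroup with \<open>h H\<close>, whatever the second component is.\<close>
  have vertsG: "(h H, b) \<in> verts ?\<Gamma>" if H: "H \<in> ?N p" and b: "b \<in> carrier K" for H b
  proof -
    have "\<not> ?N p \<subseteq> {H}" using p(2) card_mono[of "{H}" "?N p"] by auto
    then obtain H' where H': "H' \<in> ?N p" "H' \<noteq> H" by blast
    have "\<not> joint_cyclic G (h H) (h H')"
      using G.prime_ray_joint_cyclic[OF G(2) primep _ h(3)[OF H] h(3)[OF H'(1)]] H'(2) by blast
    then show ?thesis unfolding verts using h(1)[OF H] h(1)[OF H'(1)] b by blast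
  qed
  have "?N p \<noteq> {}" using p(2) by (metis card.empty not_numeral_le_zero)
  then obtain H0 where H0: "H0 \<in> ?N p" by blast
  obtain r0 where r0: "r0 \<in> R" using K.other_ray by blast
  have "\<forall>r\<in>R. \<exists>u. u \<in> carrier K \<and> \<rho> u = Some r" using K.exists_on_ray by blast
  then obtain k where k: "\<And>r. r \<in> R \<Longrightarrow> k r \<in> carrier K \<and> \<rho> (k r) = Some r" by metis
  have oneG: "\<one>\<^bsub>G\<^esub> \<in> carrier G" and oneK: "\<one>\<^bsub>K\<^esub> \<in> carrier K" by simp_all
  have h_neq: "h H \<noteq> \<one>\<^bsub>G\<^esub>" if "H \<in> ?N p" for H
    using h(2)[OF that] G.generate_one that primep prime_gt_1_nat[of p] by auto
  have k_neq: "k r \<noteq> \<one>\<^bsub>K\<^esub>" if r: "r \<in> R" for r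
  proof
    assume "k r = \<one>\<^bsub>K\<^esub>"
    moreover obtain v where "v \<in> carrier K" "\<not> joint_cyclic K (k r) v"
      using K.exists_not_joint_cyclic[of "k r" r] k[OF r] by blast
    ultimately show False using K.joint_cyclic_one by simp
  qed
  have h1: "joint_cyclic (G \<times>\<times> K) (h H, \<one>\<^bsub>K\<^esub>) (\<one>\<^bsub>G\<^esub>, b)" if "H \<in> ?N p" "b \<in> carrier K" for H b
    using jc G.joint_cyclic_one[OF h(1)[OF that(1)]] K.joint_cyclic_one[OF that(2)] joint_cyclic_sym by metis

  have "\<exists>D. total_dominating_set ?\<Gamma> D \<and> finite D \<and> card D \<le> card (?N p) + 1"
  proof -
    \<comment> \<open>\<open>?x\<close> is added to give the representatives \<open>h H\<close>,
      paired with the identity of \<open>K\<close>, a neighbour; every other vertex is joined to a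
      representative.\<close>
    let ?x = "(\<one>\<^bsub>G\<^esub>, k r0)"
    let ?D = "insert ?x ((\<lambda>H. (h H, \<one>\<^bsub>K\<^esub>)) ` ?N p)"
    have DV: "?D \<subseteq> verts ?\<Gamma>" using vertsG[OF _ oneK] vertsK[OF oneG] k[OF r0] by blast
    have "\<exists>v\<in>?D. adjacent ?\<Gamma> (a, b) v" if ab: "(a, b) \<in> verts ?\<Gamma>" for a b
    proof (cases "\<exists>H\<in>?N p. (a, b) = (h H, \<one>\<^bsub>K\<^esub>)")
      case True
      then obtain H where H: "H \<in> ?N p" "(a, b) = (h H, \<one>\<^bsub>K\<^esub>)" by blast
      have "(a, b) \<noteq> ?x" using H h_neq by simp
      then have "adjacent ?\<Gamma> (a, b) ?x"
        unfolding adj using ab DV H h1[OF H(1)] k[OF r0] by simp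
      then show ?thesis by blast
    next
      case False
      have abc: "a \<in> carrier G" "b \<in> carrier K" using ab verts by blast+
      have "\<exists>H\<in>?N p. joint_cyclic G a (h H)"
      proof (cases "prime_ray G p a")
        \<comment> \<open>An element of order prime to \<open>p\<close> commutes with
          \<open>h H0\<close> by \<open>comm\<close> and therefore shares a cyclic subgroup with
          it.\<close>
        case None
        have "\<not> p dvd G.ord a" using None unfolding prime_ray_def by (auto split: if_splits)
        moreover have "G.ord (h H0) = p"
          using G.generate_pow_card[OF h(1)[OF H0]] h(2)[OF H0] H0 by simp
        ultimately have "coprime (G.ord a) (G.ord (h H0))"
          using primep by (simp add: prime_imp_coprime coprime_commute)
        then have "joint_cyclic G a (h H0)"
          using G.joint_cyclic_coprime[OF abc(1) h(1)[OF H0]] comm[OF abc(1) h(1)[OF H0]] by blast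
        then show ?thesis using H0 by blast
      next
        case (Some H)
        note H = G.prime_ray_SomeD[OF G(2) abc(1) primep Some]
        then have HN: "H \<in> ?N p" by simp
        have "h H \<in> generate G {a}" using h(2)[OF HN] H(3) generate.incl[of "h H" "{h H}" G] by blast
        then show ?thesis using G.joint_cyclic_if_mem_generate[OF abc(1)] joint_cyclic_sym HN by metis
      qed
      then obtain H where H: "H \<in> ?N p" "joint_cyclic G a (h H)" by blast
      have "joint_cyclic (G \<times>\<times> K) (a, b) (h H, \<one>\<^bsub>K\<^esub>)"
        unfolding jc using H(2) joint_cyclic_sym[OF K.joint_cyclic_one[OF abc(2)]] by blast
      moreover have "(a, b) \<noteq> (h H, \<one>\<^bsub>K\<^esub>)" using False H(1) by blast
      ultimately have "adjacent ?\<Gamma> (a, b) (h H, \<one>\<^bsub>K\<^esub>)" unfolding adj using ab vertsG[OF H(1) oneK] by blast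
      then show ?thesis using H(1) by blast
    qed
    then have "\<exists>v\<in>?D. adjacent ?\<Gamma> u v" if "u \<in> verts ?\<Gamma>" for u
      using that by (cases u) (simp only:)
    then have "total_dominating_set ?\<Gamma> ?D" unfolding total_dominating_set_def using DV by (intro conjI ballI)
    moreover have "finite ?D" using finN by simp
    moreover have "card ?D \<le> card (?N p) + 1"
      using finN by (rule card_insert_image_le)
    ultimately show ?thesis by blast
  qed
  moreover have "\<exists>D. total_dominating_set ?\<Gamma> D \<and> finite D \<and> card D \<le> card R + 1"
  proof -
    \<comment> \<open>The mirror construction: the representatives lie on the rays of
      \<open>K\<close>, and \<open>?x\<close> is the neighbour that they need.\<close>
    let ?x = "(h H0, \<one>\<^bsub>K\<^esub>)"
    let ?D = "insert ?x ((\<lambda>r. (\<one>\<^bsub>G\<^esub>, k r)) ` R)"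
    have DV: "?D \<subseteq> verts ?\<Gamma>" using vertsG[OF H0 oneK] vertsK[OF oneG] k by blast
    have "\<exists>v\<in>?D. adjacent ?\<Gamma> (a, b) v" if ab: "(a, b) \<in> verts ?\<Gamma>" for a b
    proof (cases "\<exists>r\<in>R. (a, b) = (\<one>\<^bsub>G\<^esub>, k r)")
      case True
      then obtain r where r: "r \<in> R" "(a, b) = (\<one>\<^bsub>G\<^esub>, k r)" by blast
      have "(a, b) \<noteq> ?x" using r k_neq by simp
      moreover have "joint_cyclic (G \<times>\<times> K) (a, b) ?x"
        using joint_cyclic_sym[OF h1[OF H0]] k[OF r(1)] r(2) by simp
      ultimately have "adjacent ?\<Gamma> (a, b) ?x"
        unfolding adj using ab DV by blast
      then show ?thesis by blast
    next
      case False
      have abc: "a \<in> carrier G" "b \<in> carrier K" using ab verts by blast+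
      \<comment> \<open>An element \<open>b\<close> without a ray shares a cyclic subgroup with
        everything, so \<open>r0\<close> serves as default.\<close>
      obtain r where r: "r \<in> R" "\<rho> b = None \<or> \<rho> b = Some r"
        using r0 K.ray_in[OF abc(2)] by (cases "\<rho> b") auto
      have "joint_cyclic K b (k r)" using K.joint_cyclic_iff[OF abc(2), of "k r"] k[OF r(1)] r(2) by auto
      then have "joint_cyclic (G \<times>\<times> K) (a, b) (\<one>\<^bsub>G\<^esub>, k r)"
        unfolding jc using joint_cyclic_sym[OF G.joint_cyclic_one[OF abc(1)]] by blast
      moreover have "(a, b) \<noteq> (\<one>\<^bsub>G\<^esub>, k r)" using False r(1) by blast
      moreover have "(\<one>\<^bsub>G\<^esub>, k r) \<in> verts ?\<Gamma>" using DV r(1) by blast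
      ultimately have "adjacent ?\<Gamma> (a, b) (\<one>\<^bsub>G\<^esub>, k r)" unfolding adj using ab by blast
      then show ?thesis using r(1) by blast
    qed
    then have "\<exists>v\<in>?D. adjacent ?\<Gamma> u v" if "u \<in> verts ?\<Gamma>" for u
      using that by (cases u) (simp only:)
    then have "total_dominating_set ?\<Gamma> ?D" unfolding total_dominating_set_def using DV by (intro conjI ballI)
    moreover have "finite ?D" using K.finite_rays by simp
    moreover have "card ?D \<le> card R + 1"
      using K.finite_rays by (rule card_insert_image_le)
    ultimately show ?thesis by blast
  qed
  ultimately obtain D0 where D0: "total_dominating_set ?\<Gamma> D0" "finite D0" "card D0 \<le> ?c + 1"
    by (cases "card (?N p) \<le> card R") (auto simp: min_def)
  show ?thesis
  proof (rule strong_domination_number_eqI[OF D0], rule ccontr)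
    fix D assume D: "total_dominating_set ?\<Gamma> D" "finite D" and "\<not> ?c + 1 \<le> card D"
    then have small: "card D \<le> ?c" by linarith
    have DV: "D \<subseteq> verts ?\<Gamma>" and dom: "\<And>u. u \<in> verts ?\<Gamma> \<Longrightarrow> \<exists>v\<in>D. adjacent ?\<Gamma> u v"
      using D(1) unfolding total_dominating_set_def by blast+
    have DC: "fst d \<in> carrier G" "snd d \<in> carrier K" if "d \<in> D" for d
      using that DV verts[of "fst d" "snd d"] by auto
    \<comment> \<open>Index 0, which is not a prime, stands for the rays of \<open>K\<close>.\<close>
    define I where "I = insert 0 (prime_factors (order G))"
    \<comment> \<open>The sum type puts rays of \<open>K\<close> and subgroups of \<open>G\<close>
      into one type, since the choice lemma has a single value type for all indices.\<close>
    define \<sigma> :: "nat \<Rightarrow> 'a \<times> 'k \<Rightarrow> ('a set + 'r) option" where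
      "\<sigma> i u = (if i = 0 then map_option Inr (\<rho> (snd u)) else map_option Inl (prime_ray G i (fst u)))" for i u
    define S :: "nat \<Rightarrow> ('a set + 'r) set" where "S i = (if i = 0 then Inr ` R else Inl ` ?N i)" for i
    have prime_I: "i = 0 \<or> prime i" if "i \<in> I" for i using that unfolding I_def by auto
    have \<sigma>_jc: "\<sigma> i u = \<sigma> i v"
      if "i \<in> I" "u \<in> carrier (G \<times>\<times> K)" "v \<in> carrier (G \<times>\<times> K)" "joint_cyclic (G \<times>\<times> K) u v"
        "\<sigma> i u \<noteq> None" "\<sigma> i v \<noteq> None" for i u v
    proof -
      have j: "joint_cyclic G (fst u) (fst v)" "joint_cyclic K (snd u) (snd v)"
        using that(4) jc[of "fst u" "snd u" "fst v" "snd v"] by simp_all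
      show ?thesis
      proof (cases "i = 0")
        case True
        then show ?thesis
          using that(2,3,5,6) j(2) K.joint_cyclic_iff[of "snd u" "snd v"] unfolding \<sigma>_def by auto
      next
        case False
        then have "prime i" using prime_I that(1) by blast
        then show ?thesis
          using that(5,6) False G.prime_ray_joint_cyclic[OF G(2) _ j(1), of i] unfolding \<sigma>_def by auto
      qed
    qed
    \<comment> \<open>The graph has a vertex, so \<open>D\<close> has an element \<open>d\<close>,
      which is in turn dominated by some \<open>d'\<close> in \<open>D\<close>; this adjacent pair
      feeds the choice lemma.\<close>
    have "(h H0, \<one>\<^bsub>K\<^esub>) \<in> verts ?\<Gamma>" using vertsG[OF H0 oneK] .
    then obtain d where d: "d \<in> D" using dom by blast
    then obtain d' where d': "d' \<in> D" "adjacent ?\<Gamma> d d'" using dom DV by blast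
    obtain c where c: "\<And>i. i \<in> I \<Longrightarrow> c i \<in> S i"
      "\<And>d. d \<in> D \<Longrightarrow> \<exists>i\<in>I. \<sigma> i d \<noteq> None \<and> \<sigma> i d \<noteq> Some (c i)"
    proof (rule exists_avoiding_choice[OF D(2), of I \<sigma> d d' S])
      show "d \<in> D" "d' \<in> D" by fact+
      show "d \<noteq> d'" using d'(2) adj by blast
      show "\<sigma> i d = None \<or> \<sigma> i d' = None \<or> \<sigma> i d = \<sigma> i d'" if "i \<in> I" for i
      proof -
        have "d \<in> carrier (G \<times>\<times> K)" "d' \<in> carrier (G \<times>\<times> K)"
          using DC[OF d] DC[OF d'(1)] by (simp_all add: mem_Times_iff)
        then show ?thesis using \<sigma>_jc[OF that, of d d'] d'(2) unfolding adj by blast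
      qed
      show "card D \<le> card (S i)" if "i \<in> I" for i
      proof (cases "i = 0")
        case True
        then show ?thesis using small unfolding S_def by (simp add: card_image)
      next
        case False
        then have "?c \<le> card (?N i)" using minimal[of i] that unfolding I_def by auto
        with small have "card D \<le> card (?N i)" by (rule order_trans)
        then show ?thesis using False unfolding S_def by (simp add: card_image)
      qed
      \<comment> \<open>With no ray at any index, \<open>e\<close> has trivial first component and a
        second component without ray; it would be dominating and thus not a vertex.\<close>
      show "\<exists>i\<in>I. \<sigma> i e \<noteq> None" if e: "e \<in> D" for e
      proof (rule ccontr)
        assume none: "\<not> (\<exists>i\<in>I. \<sigma> i e \<noteq> None)"
        then have "\<sigma> 0 e = None" unfolding I_def by blast
        then have \<rho>e: "\<rho> (snd e) = None" unfolding \<sigma>_def by simp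
        have e1: "fst e = \<one>\<^bsub>G\<^esub>"
        proof (rule ccontr)
          assume "fst e \<noteq> \<one>\<^bsub>G\<^esub>"
          then obtain q where q: "q \<in> prime_factors (order G)" "prime_ray G q (fst e) \<noteq> None"
            using G.exists_prime_ray[OF G(2) DC(1)[OF e]] by blast
          then have "q \<noteq> 0" using in_prime_factors_imp_prime not_prime_0 by metis
          then have "\<sigma> q e \<noteq> None" using q(2) unfolding \<sigma>_def by simp
          then show False using none q(1) unfolding I_def by blast
        qed
        have "(fst e, snd e) \<in> verts ?\<Gamma>" using e DV by auto
        then obtain a' b' where "a' \<in> carrier G" "b' \<in> carrier K"
          "\<not> (joint_cyclic G (fst e) a' \<and> joint_cyclic K (snd e) b')" unfolding verts by blast
        then show False
          using e1 \<rho>e G.joint_cyclic_one K.joint_cyclic_iff DC[OF e] by auto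
      qed
    qed (rule that)
    obtain r where r: "r \<in> R" "c 0 = Inr r" using c(1)[of 0] unfolding I_def S_def by auto
    have "\<exists>H. c q = Inl H \<and> subgroup H G \<and> card H = q" if "q \<in> prime_factors (order G)" for q
    proof -
      have "q \<noteq> 0" using that in_prime_factors_imp_prime not_prime_0 by metis
      then show ?thesis using c(1)[of q] that unfolding I_def S_def by auto
    qed
    then obtain H where H: "\<And>q. q \<in> prime_factors (order G) \<Longrightarrow> c q = Inl (H q) \<and> subgroup (H q) G \<and> card (H q) = q"
      by metis
    \<comment> \<open>\<open>(a, k r)\<close> carries the chosen ray at every index. Its neighbour
      in \<open>D\<close> has a different ray at some index, which is impossible within a common
      cyclic subgroup.\<close>
    obtain a where a: "a \<in> carrier G" "\<And>q. q \<in> prime_factors (order G) \<Longrightarrow> prime_ray G q a = Some (H q)"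
      using G.exists_with_prime_rays[OF G(2) comm, of "prime_factors (order G)" H] H by auto
    have \<sigma>v: "\<sigma> i (a, k r) = Some (c i)" if "i \<in> I" for i
    proof (cases "i = 0")
      case True
      then show ?thesis using k[OF r(1)] r(2) unfolding \<sigma>_def by simp
    next
      case False
      then have "i \<in> prime_factors (order G)" using that unfolding I_def by blast
      then show ?thesis using a(2) H False unfolding \<sigma>_def by simp
    qed
    have v: "(a, k r) \<in> verts ?\<Gamma>" using vertsK a(1) k[OF r(1)] by blast
    then obtain d where d: "d \<in> D" "adjacent ?\<Gamma> (a, k r) d" using dom by blast
    obtain i where i: "i \<in> I" "\<sigma> i d \<noteq> None" "\<sigma> i d \<noteq> Some (c i)" using c(2)[OF d(1)] by blast
    have "d \<in> carrier (G \<times>\<times> K)" using DC[OF d(1)] by (simp add: mem_Times_iff)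
    moreover have "(a, k r) \<in> carrier (G \<times>\<times> K)" using a(1) k[OF r(1)] by simp
    moreover have "joint_cyclic (G \<times>\<times> K) (a, k r) d" using d(2) unfolding adj by blast
    ultimately have "\<sigma> i (a, k r) = \<sigma> i d" using \<sigma>_jc[OF i(1) _ _ _ _ i(2)] \<sigma>v[OF i(1)] by blast
    then show False using \<sigma>v[OF i(1)] i(3) by simp
  qed
qed

section \<open>Products of Sylow subgroups\<close>

text \<open>\<open>\<phi>\<close> is any isomorphism onto the external product; it is not assumed to
  carry \<open>P i\<close> onto the \<open>i\<close>-th factor.\<close>

locale sylow_product = group G for G (structure) +
  fixes I :: "'i set" and P :: "'i \<Rightarrow> 'a set" and p e :: "'i \<Rightarrow> nat" and \<phi> :: "'a \<Rightarrow> 'i \<Rightarrow> 'a"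
  assumes finite_carrier: "finite (carrier G)"
    and iso: "\<phi> \<in> iso G (product_group I (\<lambda>i. G\<lparr>carrier := P i\<rparr>))"
    and subgroup_P: "\<And>i. i \<in> I \<Longrightarrow> subgroup (P i) G"
    and card_P: "\<And>i. i \<in> I \<Longrightarrow> card (P i) = p i ^ e i"
    and prime_p: "\<And>i. i \<in> I \<Longrightarrow> prime (p i)"
    and inj_p: "inj_on p I"
begin

lemma component_hom:
  assumes "i \<in> I"
  shows "group_hom G (G\<lparr>carrier := P i\<rparr>) (\<lambda>a. \<phi> a i)"
proof (intro group_hom.intro group_hom_axioms.intro homI)
  show "group G" by (rule group_axioms)
  show "group (G\<lparr>carrier := P i\<rparr>)" using subgroup_imp_group subgroup_P assms by blast
  have hom: "\<phi> \<in> hom G (product_group I (\<lambda>i. G\<lparr>carrier := P i\<rparr>))" using iso unfolding iso_def by blast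
  show "\<phi> a i \<in> carrier (G\<lparr>carrier := P i\<rparr>)" if "a \<in> carrier G" for a
    using hom_in_carrier[OF hom that] assms by (auto simp: PiE_iff)
  show "\<phi> (a \<otimes> b) i = \<phi> a i \<otimes>\<^bsub>G\<lparr>carrier := P i\<rparr>\<^esub> \<phi> b i" if "a \<in> carrier G" "b \<in> carrier G" for a b
    using hom_mult[OF hom that] assms by simp
qed

lemma components_eqI:
  assumes "a \<in> carrier G" "b \<in> carrier G" "\<And>i. i \<in> I \<Longrightarrow> \<phi> a i = \<phi> b i"
  shows "a = b"
proof -
  have bij: "bij_betw \<phi> (carrier G) (\<Pi>\<^sub>E i\<in>I. P i)" using iso unfolding iso_def by simp
  then have "\<phi> a \<in> (\<Pi>\<^sub>E i\<in>I. P i)" "\<phi> b \<in> (\<Pi>\<^sub>E i\<in>I. P i)" using assms(1,2) bij_betwE by blast+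
  then have "\<phi> a = \<phi> b" using assms(3) by (rule PiE_ext)
  then show ?thesis using bij assms(1,2) unfolding bij_betw_def by (meson inj_onD)
qed

text \<open>The order of the component divides both \<open>ord a\<close> and a power of
  \<open>p i\<close>.\<close>

lemma component_eq_one:
  assumes "i \<in> I" "a \<in> carrier G" "coprime (ord a) (p i)"
  shows "\<phi> a i = \<one>"
proof -
  interpret h: group_hom G "G\<lparr>carrier := P i\<rparr>" "\<lambda>a. \<phi> a i" using assms(1) by (rule component_hom)
  have c: "\<phi> a i \<in> P i" using h.hom_closed[OF assms(2)] by simp
  have cG: "\<phi> a i \<in> carrier G" using c subgroup.mem_carrier[OF subgroup_P[OF assms(1)]] by blast
  have "\<phi> a i [^] ord a = \<one>"
    using h.hom_nat_pow[OF assms(2), of "ord a"] assms(2) h.hom_one by (simp add: nat_pow_consistent[symmetric])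
  then have 1: "ord (\<phi> a i) dvd ord a" using pow_eq_id[OF cG] by blast
  have "\<phi> a i [^] (p i ^ e i) = \<one>"
    using subgroup_pow_card[OF subgroup_P[OF assms(1)] c] card_P[OF assms(1)] by simp
  then have 2: "ord (\<phi> a i) dvd p i ^ e i" using pow_eq_id[OF cG] by blast
  have "coprime (ord a) (p i ^ e i)" using assms(3) by simp
  then have "ord (\<phi> a i) = 1" using 1 2 by (metis coprime_common_divisor_nat)
  then show ?thesis using ord_eq_1[OF cG] by blast
qed

text \<open>No \<open>p i\<close> divides both orders, so at each index one of the two components is
  trivial.\<close>

lemma coprime_orders_commute:
  assumes a: "a \<in> carrier G" and b: "b \<in> carrier G" and co: "coprime (ord a) (ord b)"
  shows "a \<otimes> b = b \<otimes> a"
proof (rule components_eqI)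
  fix i assume i: "i \<in> I"
  interpret h: group_hom G "G\<lparr>carrier := P i\<rparr>" "\<lambda>a. \<phi> a i" using i by (rule component_hom)
  have c: "\<phi> a i \<in> carrier G" "\<phi> b i \<in> carrier G"
    using h.hom_closed[OF a] h.hom_closed[OF b] subgroup.mem_carrier[OF subgroup_P[OF i]] by simp_all
  have "coprime (ord a) (p i) \<or> coprime (ord b) (p i)"
  proof (rule ccontr)
    assume "\<not> ?thesis"
    then have "p i dvd ord a" "p i dvd ord b"
      using prime_imp_coprime[OF prime_p[OF i]] coprime_commute by blast+
    then have "p i dvd 1" using co coprime_common_divisor by blast
    then show False using prime_p[OF i] not_prime_unit by blast
  qed
  then have "\<phi> a i = \<one> \<or> \<phi> b i = \<one>" using component_eq_one i a b by blast
  then have "\<phi> a i \<otimes> \<phi> b i = \<phi> b i \<otimes> \<phi> a i" using c by auto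
  then show "\<phi> (a \<otimes> b) i = \<phi> (b \<otimes> a) i" using h.hom_mult[OF a b] h.hom_mult[OF b a] by simp
qed (use a b in simp_all)

text \<open>The elements with trivial components away from \<open>i\<close> include all elements of
  \<open>p i\<close>-power order, hence \<open>P i\<close>; their \<open>i\<close>-th component
  embeds them into \<open>P i\<close>. By counting, \<open>P i\<close> is exactly this set.\<close>

lemma mem_P_if_prime_power_ord:
  assumes i: "i \<in> I" and u: "u \<in> carrier G" "ord u dvd p i ^ l"
  shows "u \<in> P i"
proof -
  let ?E = "{u \<in> carrier G. \<forall>j\<in>I - {i}. \<phi> u j = \<one>}"
  have E: "u \<in> ?E" if "u \<in> carrier G" "ord u dvd p i ^ l" for u l
  proof -
    have "\<phi> u j = \<one>" if j: "j \<in> I - {i}" for j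
    proof (rule component_eq_one)
      have "p i \<noteq> p j" using inj_onD[OF inj_p, of i j] i j by blast
      then have "coprime (p i) (p j)" using primes_coprime prime_p i j by blast
      then have "coprime (p i ^ l) (p j)" by simp
      then show "coprime (ord u) (p j)" using \<open>ord u dvd p i ^ l\<close> by (meson coprime_divisors dvd_refl)
    qed (use j that \<open>u \<in> carrier G\<close> in simp_all)
    then show ?thesis using that(1) by blast
  qed
  have P: "subgroup (P i) G" using subgroup_P i .
  have finE: "finite ?E" using finite_carrier by simp
  have "P i \<subseteq> ?E"
  proof
    fix v assume v: "v \<in> P i"
    have "v \<in> carrier G" using subgroup.mem_carrier[OF P v] .
    moreover have "ord v dvd p i ^ e i"
      using subgroup_pow_card[OF P v] card_P[OF i] pow_eq_id calculation by simp
    ultimately show "v \<in> ?E" by (rule E)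
  qed
  moreover have "card ?E \<le> card (P i)"
  proof (rule card_inj_on_le)
    show "inj_on (\<lambda>u. \<phi> u i) ?E"
    proof (rule inj_onI)
      fix a b assume ab: "a \<in> ?E" "b \<in> ?E" "\<phi> a i = \<phi> b i"
      then have "\<phi> a j = \<phi> b j" if "j \<in> I" for j using that by (cases "j = i") auto
      then show "a = b" using components_eqI ab by blast
    qed
    interpret h: group_hom G "G\<lparr>carrier := P i\<rparr>" "\<lambda>a. \<phi> a i" using i by (rule component_hom)
    show "(\<lambda>u. \<phi> u i) ` ?E \<subseteq> P i" using h.hom_closed by auto
    show "finite (P i)" using finite_carrier subgroup.subset[OF P] finite_subset by blast
  qed
  ultimately have "P i = ?E" using finE by (simp add: card_seteq)
  then show ?thesis using E[OF u] by blast
qed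

text \<open>A subgroup of order \<open>p i\<close> consists of elements of order dividing
  \<open>p i\<close>, which lie in \<open>P i\<close>. Thus the rays at \<open>p i\<close> can be
  counted in the whole group.\<close>

lemma prime_card_subgroups_eq:
  assumes i: "i \<in> I"
  shows "{H. subgroup H (G\<lparr>carrier := P i\<rparr>) \<and> card H = p i} = {H. subgroup H G \<and> card H = p i}"
proof -
  have P: "subgroup (P i) G" using subgroup_P i .
  have "subgroup H (G\<lparr>carrier := P i\<rparr>)" if H: "subgroup H G" "card H = p i" for H
  proof -
    have "H \<subseteq> P i"
    proof
      fix u assume u: "u \<in> H"
      have uc: "u \<in> carrier G" using subgroup.mem_carrier[OF H(1) u] .
      have "ord u dvd p i ^ 1" using subgroup_pow_card[OF H(1) u] H(2) pow_eq_id[OF uc] by simp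
      then show "u \<in> P i" using mem_P_if_prime_power_ord[OF i uc] by blast
    qed
    then show ?thesis using subgroup_incl[OF H(1) P] by simp
  qed
  then show ?thesis using incl_subgroup[OF P] by blast
qed

end

section \<open>Assembly of both statements\<close>

theorem theorem2p4:
  fixes k n m :: nat
    and G :: "('g, 'x) monoid_scheme"
    and Q :: "('q, 'y) monoid_scheme"
    and G1 :: "('a, 'z) monoid_scheme"
    and P :: "nat \<Rightarrow> 'a set"
    and p r :: "nat \<Rightarrow> nat"
  assumes "k \<ge> 3"
    and "n > 0" and "odd n"
    and "generalized_quaternion k Q"
    and "group G1" and "finite (carrier G1)" and "nilpotent_group G1" and "odd (order G1)"
    and "m \<ge> 1"
    and "bij_betw p {1..m} (prime_factors (order G1))"
    and "\<And>i. i \<in> {1..m} \<Longrightarrow> sylow_subgroup (p i) (P i) G1"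
    and "G1 \<cong> product_group {1..m} (\<lambda>i. G1\<lparr>carrier := P i\<rparr>)"
    and "\<And>i. i \<in> {1..m} \<Longrightarrow> \<not> cyclic_group (G1\<lparr>carrier := P i\<rparr>)"
    and "\<And>i. i \<in> {1..m} \<Longrightarrow>
      r i = card {H. subgroup H (G1\<lparr>carrier := P i\<rparr>) \<and> card H = p i}"
    and "mono_on {1..m} r"
    and "group G"
  shows "(G \<cong> Q \<or> G \<cong> integer_mod_group n \<times>\<times> Q \<longrightarrow>
      strong_domination_number (proper_enhanced_power_graph G) = 2 ^ (k - 1) + 2) \<and>
    (G \<cong> G1 \<times>\<times> Q \<or> (gcd (order G1) n = 1 \<and> G \<cong> G1 \<times>\<times> integer_mod_group n \<times>\<times> Q) \<longrightarrow>
      strong_domination_number (proper_enhanced_power_graph G) = min (r 1) (2 ^ (k - 2) + 1) + 1)"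
proof -
  let ?Z = "integer_mod_group n"
  interpret G1: group G1 by fact
  obtain \<rho> :: "'q \<Rightarrow> 'q set option" and R where Q: "ray_group Q \<rho> R" and R: "card R = 2 ^ (k - 2) + 1"
    using generalized_quaternion_ray_group[OF assms(4,1)] by blast
  interpret Q: ray_group Q \<rho> R by fact
  have ordQ: "order Q = 2 ^ k" using assms(4) unfolding generalized_quaternion_def by blast
  have finZ: "finite (carrier ?Z)" and ordZ: "order ?Z = n"
    using assms(2) by (simp_all add: carrier_integer_mod_group order_def)
  have "coprime (order ?Z) (order Q)" using assms(3) ordQ ordZ by simp
  then have ZQ: "ray_group (?Z \<times>\<times> Q) (\<lambda>u. \<rho> (snd u)) R"
    using Q.DirProd_cyclic[OF group_integer_mod_group finZ] joint_cyclic_integer_mod_group assms(2) by blast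
  have ordZQ: "order (?Z \<times>\<times> Q) = n * 2 ^ k"
    using ordZ ordQ by (simp add: order_def card_cartesian_product)
  have twice: "2 * card R = 2 ^ (k - 1) + 2"
  proof -
    have "k - 1 = Suc (k - 2)" using assms(1) by simp
    then show ?thesis using R by simp
  qed
  \<comment> \<open>Kept general in \<open>K\<close> and its type: \<open>Q\<close> and its product
    with the cyclic group have the same set of rays \<open>R\<close>.\<close>
  have a: "strong_domination_number (proper_enhanced_power_graph G) = 2 ^ (k - 1) + 2"
    if K: "ray_group K \<rho>' R" "G \<cong> K" for K :: "('b, 'c) monoid_scheme" and \<rho>'
    using strong_domination_number_proper_enhanced_power_graph_iso[OF assms(16) _ K(2)]
      ray_group.strong_domination_number_rays[OF K(1)] ray_group.axioms(1)[OF K(1)] twice by simp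

  obtain \<phi> where \<phi>: "\<phi> \<in> iso G1 (product_group {1..m} (\<lambda>i. G1\<lparr>carrier := P i\<rparr>))"
    using assms(12) unfolding is_iso_def by blast
  let ?e = "\<lambda>i. multiplicity (p i) (order G1)"
  interpret S: sylow_product G1 "{1..m}" P p ?e \<phi>
  proof (intro sylow_product.intro sylow_product_axioms.intro)
    show "inj_on p {1..m}" using assms(10) unfolding bij_betw_def by blast
    show "subgroup (P i) G1" "card (P i) = p i ^ ?e i" "prime (p i)" if "i \<in> {1..m}" for i
      using assms(11)[OF that] unfolding sylow_subgroup_def by blast+
  qed (fact assms(5,6) \<phi>)+
  let ?N = "\<lambda>q. {H. subgroup H G1 \<and> card H = q}"
  have r: "r i = card (?N (p i))" if "i \<in> {1..m}" for i
    using assms(14)[OF that] S.prime_card_subgroups_eq[OF that] by simp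
  have one: "1 \<in> {1..m}" using assms(9) by simp
  have p1: "p 1 \<in> prime_factors (order G1)" using assms(10) one bij_betwE by blast
  then have "odd (p 1)" using assms(8) by (meson dvd_trans in_prime_factors_iff)
  have noncyclic: "generate G1 {a} \<noteq> P 1" if a: "a \<in> P 1" for a
  proof
    assume eq: "generate G1 {a} = P 1"
    have sub: "subgroup (P 1) G1" using S.subgroup_P one .
    interpret P1: group "G1\<lparr>carrier := P 1\<rparr>" using G1.subgroup_imp_group[OF sub] .
    have "a [^]\<^bsub>G1\<lparr>carrier := P 1\<rparr>\<^esub> j = a [^]\<^bsub>G1\<^esub> j" for j :: int
      using G1.int_pow_consistent[OF sub a] by simp
    then have "carrier (G1\<lparr>carrier := P 1\<rparr>) = range (\<lambda>j::int. a [^]\<^bsub>G1\<lparr>carrier := P 1\<rparr>\<^esub> j)"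
      using eq G1.generate_pow[OF subgroup.mem_carrier[OF sub a]] by (simp add: full_SetCompr_eq)
    then have "cyclic_group (G1\<lparr>carrier := P 1\<rparr>)" unfolding P1.cyclic_group using a by auto
    then show False using assms(13)[OF one] by blast
  qed
  obtain H K where HK: "H \<in> ?N (p 1)" "K \<in> ?N (p 1)" "H \<noteq> K"
    using G1.odd_p_group_two_subgroups[OF assms(6,7) S.subgroup_P[OF one] S.card_P[OF one] S.prime_p[OF one] \<open>odd (p 1)\<close> noncyclic]
    by blast
  have "?N q \<subseteq> Pow (carrier G1)" for q using subgroup.subset by blast
  then have "finite (?N (p 1))" using assms(6) finite_subset by blast
  then have two: "card (?N (p 1)) \<ge> 2" using card_mono[of "?N (p 1)" "{H, K}"] HK by simp
  \<comment> \<open>Every prime factor is some \<open>p i\<close>, and monotonicity of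
    \<open>r\<close> makes index 1 the least.\<close>
  have minimal: "card (?N (p 1)) \<le> card (?N q)" if q: "q \<in> prime_factors (order G1)" for q
  proof -
    obtain i where i: "i \<in> {1..m}" "q = p i" using q assms(10) unfolding bij_betw_def by blast
    then have "r 1 \<le> r i" using assms(15) one by (auto simp: mono_on_def)
    then show ?thesis using r[OF one] r[OF i(1)] i(2) by simp
  qed
  have b: "strong_domination_number (proper_enhanced_power_graph G) = min (r 1) (2 ^ (k - 2) + 1) + 1"
    if K: "ray_group K \<rho>' R" "coprime (order G1) (order K)" "G \<cong> G1 \<times>\<times> K"
    for K :: "('b, 'c) monoid_scheme" and \<rho>'
  proof -
    have "group (G1 \<times>\<times> K)" using DirProd_group[OF assms(5) ray_group.axioms(1)[OF K(1)]] .
    then have "strong_domination_number (proper_enhanced_power_graph G) =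
        strong_domination_number (proper_enhanced_power_graph (G1 \<times>\<times> K))"
      using strong_domination_number_proper_enhanced_power_graph_iso[OF assms(16) _ K(3)] by blast
    also have "\<dots> = min (card (?N (p 1))) (card R) + 1"
      using strong_domination_number_DirProd_rays[OF assms(5,6) S.coprime_orders_commute K(1,2) p1 two minimal] .
    finally show ?thesis using r[OF one] R by simp
  qed
  have co: "coprime (order G1) (2 ^ k)" using assms(8) by simp
  have "coprime (order G1) (n * 2 ^ k)" if "gcd (order G1) n = 1"
  proof -
    have "coprime (order G1) n" using that by (simp only: coprime_iff_gcd_eq_1)
    then show ?thesis using co by simp
  qed
  then show ?thesis using a[OF Q] a[OF ZQ] b[OF Q] b[OF ZQ] co ordQ ordZQ by auto
qed

end
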